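(* Let $N\ge 2$ and let $f\colon\mathbb{R}^N\times\mathbb{R}^N\to[0,+\infty]$ be a Borel function such that $f\in L^1_{\mathrm{loc}}(\mathbb{R}^{2N})$. Assume that there exist a radial Borel function $g\colon\mathbb{R}^N\to[0,+\infty]$ and a lower semicontinuous, positively $1$-homogeneous and convex function $\Phi\colon\mathbb{R}^N\to[0,+\infty]$ with $\Phi(v)>0$ for every $v\in\mathbb{R}^N\setminus\{0\}$ such that $$f(x,v)=g(x)\,\Phi(v)\quad\text{for all } x\in\mathbb{R}^N \text{ and } v\in\mathbb{R}^N.$$ For every convex body $E\subset\mathbb{R}^N$ let $$P_f(E)=\int_{\partial E} f\big(x,\nu_E(x)\big)\,\mathrm{d}\mathscr{H}^{N-1}(x).$$ If $P_f(A)\le P_f(B)$ for any two convex bodies $A,B\subset\mathbb{R}^N$ with $A\subset B$, then there exists a constant $c\ge 0$ such that $g(x)=c$ for Lebesgue-a.e. $x\in\mathbb{R}^N$.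
   Context: A convex body in $\mathbb{R}^N$ is a compact convex subset of $\mathbb{R}^N$ with non-empty interior. $\mathscr{H}^{N-1}$ denotes the $(N-1)$-dimensional Hausdorff measure on $\mathbb{R}^N$, and $\partial E$ is the topological boundary of $E$. For a convex body $E$, $\nu_E\colon\partial E\to\mathbb{S}^{N-1}$ denotes the inner unit normal of $E$, which is defined $\mathscr{H}^{N-1}$-a.e. on $\partial E$. The value $P_f(E)$ is allowed to be $+\infty$. A function $g$ on $\mathbb{R}^N$ is radial if $g(x)$ depends only on $|x|$. Positively $1$-homogeneous means $\Phi(tv)=t\,\Phi(v)$ for all $t>0$ and $v\in\mathbb{R}^N$. The usual measure-theoretic convention $0\cdot(+\infty)=0$ is used. *)

theory Defs
  imports "HOL-Analysis.Analysis"
begin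

(* The usual gauge omega_m (diam C / 2)^m.  The empty set is treated separately because
   0 ^ 0 = 1 would give it mass 1 for m = 0. *)
definition hausdorff_gauge :: "nat \<Rightarrow> 'a::metric_space set \<Rightarrow> ennreal" where
  "hausdorff_gauge m C =
     (if C = {} then 0 else ennreal (unit_ball_vol (real m) * (diameter C / 2) ^ m))"

(* "bounded" is needed since diameter is unspecified on unbounded sets. *)
definition hausdorff_premeasure :: "nat \<Rightarrow> real \<Rightarrow> 'a::metric_space set \<Rightarrow> ennreal" where
  "hausdorff_premeasure m \<delta> A =
     (INF C \<in> {C :: nat \<Rightarrow> 'a set. A \<subseteq> (\<Union>i. C i) \<and> (\<forall>i. bounded (C i) \<and> diameter (C i) \<le> \<delta>)}.
        \<Sum>i. hausdorff_gauge m (C i))"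

definition hausdorff_outer_measure :: "nat \<Rightarrow> 'a::metric_space set \<Rightarrow> ennreal" where
  "hausdorff_outer_measure m A = (SUP \<delta> \<in> {0<..}. hausdorff_premeasure m \<delta> A)"

(* The outer measure is a metric outer measure, so by Caratheodory's criterion it is countably
   additive on the Borel sets and measure_of does not collapse to the zero measure. *)
definition hausdorff_measure :: "nat \<Rightarrow> 'a::metric_space measure" where
  "hausdorff_measure m = measure_of UNIV (sets borel) (hausdorff_outer_measure m)"

definition convex_body :: "'a::euclidean_space set \<Rightarrow> bool" where
  "convex_body E \<longleftrightarrow> compact E \<and> convex E \<and> interior E \<noteq> {}"

definition inner_unit_normal_at :: "'a::euclidean_space set \<Rightarrow> 'a \<Rightarrow> 'a \<Rightarrow> bool" where
  "inner_unit_normal_at E x v \<longleftrightarrow> norm v = 1 \<and> (\<forall>y\<in>E. 0 \<le> (y - x) \<bullet> v)"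

(* At almost every boundary point of a convex body there is exactly one inner unit normal.
   The value 0 at the remaining boundary points, which form a Borel null set, is irrelevant for
   integrals over the boundary. *)
definition inner_normal :: "'a::euclidean_space set \<Rightarrow> 'a \<Rightarrow> 'a" where
  "inner_normal E x =
     (if \<exists>!v. inner_unit_normal_at E x v then THE v. inner_unit_normal_at E x v else 0)"

definition perimeter :: "('a \<times> 'a \<Rightarrow> ennreal) \<Rightarrow> 'a::euclidean_space set \<Rightarrow> ennreal" where
  "perimeter f E =
     (\<integral>\<^sup>+ x \<in> frontier E. f (x, inner_normal E x) \<partial>hausdorff_measure (DIM('a) - 1))"

definition locally_integrable :: "('a::euclidean_space \<Rightarrow> ennreal) \<Rightarrow> bool" where
  "locally_integrable f \<longleftrightarrow>
     f \<in> borel_measurable lebesgue \<and> (\<forall>K. compact K \<longrightarrow> (\<integral>\<^sup>+ x \<in> K. f x \<partial>lebesgue) < \<infinity>)"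

definition radial :: "('a::real_normed_vector \<Rightarrow> 'b) \<Rightarrow> bool" where
  "radial g \<longleftrightarrow> (\<forall>x y. norm x = norm y \<longrightarrow> g x = g y)"

definition lower_semicontinuous :: "('a::topological_space \<Rightarrow> ennreal) \<Rightarrow> bool" where
  "lower_semicontinuous \<Phi> \<longleftrightarrow> (\<forall>x. \<Phi> x \<le> Liminf (at x) \<Phi>)"

definition positively_1_homogeneous :: "('a::real_vector \<Rightarrow> ennreal) \<Rightarrow> bool" where
  "positively_1_homogeneous \<Phi> \<longleftrightarrow> (\<forall>t>0. \<forall>v. \<Phi> (t *\<^sub>R v) = ennreal t * \<Phi> v)"

(* The library's convex_on is restricted to real-valued functions. *)
definition ennreal_convex :: "('a::real_vector \<Rightarrow> ennreal) \<Rightarrow> bool" where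
  "ennreal_convex \<Phi> \<longleftrightarrow>
     (\<forall>x y. \<forall>u\<ge>0. \<forall>v\<ge>0. u + v = 1 \<longrightarrow>
        \<Phi> (u *\<^sub>R x + v *\<^sub>R y) \<le> ennreal u * \<Phi> x + ennreal v * \<Phi> y)"

end

theory Submission
  imports Defs
begin

text \<open>
  Unless \<open>g\<close> vanishes almost everywhere, local integrability and convexity make the anisotropy \<open>\<Phi>\<close>
  finite and continuous, so it attains a maximum \<open>M > 0\<close> on the unit sphere. Let \<open>w\<close> be the opposite of a maximising direction and let \<open>D\<close> be a small flat disc
  orthogonal to \<open>w\<close>. Two convex bodies are compared: a cone with base \<open>D\<close>, lying on the side of
  \<open>- w\<close>, and the same cone with a very flat cone of slope \<open>d\<close> glued onto \<open>D\<close> on the other side.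
  They have the lower mantle in common, with equal normals there. On \<open>D\<close> the inner normal is \<open>- w\<close>,
  where \<open>\<Phi>\<close> equals \<open>M\<close>, and on the new mantle \<open>\<Phi>\<close> is at most \<open>M\<close>. Hence the monotonicity of the
  perimeter says, without any reference to \<open>\<Phi>\<close>, that the integral of \<open>g\<close> over \<open>D\<close> is at most its
  integral over the raised disc (\<open>disc_integral_le_lift\<close>). Raising the disc costs a factor
  \<open>1 + O(d\<^sup>2)\<close> of area but moves its points by a distance of order \<open>d\<close>, so \<open>g\<close> cannot decrease to
  first order in the direction \<open>w\<close>.

  As \<open>g\<close> is only locally integrable, this is carried out for averages. Translating both bodies and
  integrating over the translations shows that every average of translates of \<open>g\<close> inherits the
  hypothesis (\<open>weighted_perimeter_average\<close>). Averaging over balls gives a continuous function, and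
  averaging that function over segments parallel to \<open>w\<close> gives a function whose increments in the
  direction \<open>w\<close> are explicit. The outcome is that \<open>x \<mapsto> \<integral> g\<close> over the ball of radius \<open>e\<close> around \<open>x\<close> is
  nondecreasing in the direction \<open>w\<close> (\<open>ball_mass_mono_along_axis\<close>). It is also radial, so along
  the line spanned by \<open>w\<close> it is both nondecreasing and even, hence constant there, and then constant
  everywhere. A locally integrable function with constant ball masses is constant almost everywhere
  (\<open>AE_const_if_ball_mass_const\<close>).

  Three properties of the \<open>m\<close>-dimensional Hausdorff measure carry the argument: it is a measure on the
  Borel sets, an \<open>L\<close>-Lipschitz map increases it at most by the factor \<open>L ^ m\<close>, which includes
  translation invariance, and for \<open>m = N - 1\<close> a flat disc has positive finite measure.
\<close>

section \<open>Hausdorff measure on the Borel sets\<close>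

lemma hausdorff_premeasure_le:
  assumes "A \<subseteq> (\<Union>i. C i)" "\<And>i. bounded (C i)" "\<And>i. diameter (C i) \<le> \<delta>"
  shows "hausdorff_premeasure m \<delta> A \<le> (\<Sum>i. hausdorff_gauge m (C i))"
  unfolding hausdorff_premeasure_def using assms by (intro INF_lower) auto

lemma hausdorff_premeasure_mono:
  assumes "A \<subseteq> B" shows "hausdorff_premeasure m \<delta> A \<le> hausdorff_premeasure m \<delta> B"
  unfolding hausdorff_premeasure_def using assms by (intro INF_superset_mono) auto

lemma hausdorff_premeasure_antimono:
  assumes "\<delta> \<le> \<delta>'" shows "hausdorff_premeasure m \<delta>' A \<le> hausdorff_premeasure m \<delta> A"
  unfolding hausdorff_premeasure_def using assms by (intro INF_superset_mono) (auto intro: order_trans)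

lemma hausdorff_premeasure_empty:
  assumes "\<delta> \<ge> 0" shows "hausdorff_premeasure m \<delta> {} = 0"
proof -
  have "hausdorff_premeasure m \<delta> ({}::'a set) \<le> (\<Sum>i::nat. hausdorff_gauge m ({}::'a set))"
    using assms by (intro hausdorff_premeasure_le) auto
  thus ?thesis by (simp add: hausdorff_gauge_def)
qed

text \<open>
  Cover each \<open>A i\<close> up to an error \<open>e / 2 ^ (i + 1)\<close> and enumerate all the covering sets in one sequence.
\<close>

lemma hausdorff_premeasure_UN:
  fixes A :: "nat \<Rightarrow> 'a::metric_space set"
  shows "hausdorff_premeasure m \<delta> (\<Union>i. A i) \<le> (\<Sum>i. hausdorff_premeasure m \<delta> (A i))"
proof (rule ennreal_le_epsilon)
  fix e :: real
  assume fin: "(\<Sum>i. hausdorff_premeasure m \<delta> (A i)) < top" and e: "0 < e"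
  have fini: "hausdorff_premeasure m \<delta> (A i) \<noteq> \<infinity>" for i
    using ennreal_suminf_lessD[OF fin, of i] by auto
  have "\<exists>C. A i \<subseteq> (\<Union>j. C j) \<and> (\<forall>j::nat. bounded (C j) \<and> diameter (C j) \<le> \<delta>) \<and>
      (\<Sum>j. hausdorff_gauge m (C j)) < hausdorff_premeasure m \<delta> (A i) + ennreal (e * (1/2) ^ Suc i)" for i
    using INF_approx_ennreal[of "e * (1/2) ^ Suc i" "hausdorff_premeasure m \<delta> (A i)",
        OF _ hausdorff_premeasure_def fini] e
    by auto
  then obtain C where C: "\<And>i. A i \<subseteq> (\<Union>j. C i j)" "\<And>i j::nat. bounded (C i j)" "\<And>i j. diameter (C i j) \<le> \<delta>"
    "\<And>i. (\<Sum>j. hausdorff_gauge m (C i j)) \<le> hausdorff_premeasure m \<delta> (A i) + ennreal (e * (1/2) ^ Suc i)"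
    by (metis order_less_imp_le)
  have "(\<Union>i. A i) \<subseteq> (\<Union>k. case_prod C (prod_decode k))"
  proof
    fix x assume "x \<in> (\<Union>i. A i)"
    then obtain i j where "x \<in> C i j" using C(1) by blast
    hence "x \<in> case_prod C (prod_decode (prod_encode (i,j)))" by simp
    thus "x \<in> (\<Union>k. case_prod C (prod_decode k))" by (rule UN_I[OF UNIV_I])
  qed
  hence "hausdorff_premeasure m \<delta> (\<Union>i. A i) \<le> (\<Sum>k. hausdorff_gauge m (case_prod C (prod_decode k)))"
    by (rule hausdorff_premeasure_le) (auto split: prod.split intro: C(2,3))
  also have "\<dots> = (\<Sum>i. \<Sum>j. hausdorff_gauge m (C i j))"
    by (subst suminf_ennreal_2dimen[symmetric, where f = "\<lambda>p. hausdorff_gauge m (case_prod C p)"]) auto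
  also have "\<dots> \<le> (\<Sum>i. hausdorff_premeasure m \<delta> (A i) + ennreal (e * (1/2) ^ Suc i))"
    by (intro suminf_le C(4)) auto
  also have "\<dots> = (\<Sum>i. hausdorff_premeasure m \<delta> (A i)) + (\<Sum>i. ennreal e * ennreal ((1/2) ^ Suc i))"
    using e by (subst suminf_add[symmetric])
      (auto simp del: ennreal_suminf_cmult simp add: ennreal_mult[symmetric])
  also have "\<dots> = (\<Sum>i. hausdorff_premeasure m \<delta> (A i)) + ennreal e"
    unfolding ennreal_suminf_cmult
    by (subst suminf_ennreal_eq[OF zero_le_power power_half_series]) auto
  finally show "hausdorff_premeasure m \<delta> (\<Union>i. A i) \<le> (\<Sum>i. hausdorff_premeasure m \<delta> (A i)) + ennreal e" .
qed

lemma hausdorff_premeasure_le_outer: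
  "\<delta> > 0 \<Longrightarrow> hausdorff_premeasure m \<delta> A \<le> hausdorff_outer_measure m A"
  unfolding hausdorff_outer_measure_def by (intro SUP_upper) auto

lemma hausdorff_outer_measure_mono:
  "A \<subseteq> B \<Longrightarrow> hausdorff_outer_measure m A \<le> hausdorff_outer_measure m B"
  unfolding hausdorff_outer_measure_def by (intro SUP_mono') (auto intro: hausdorff_premeasure_mono)

lemma hausdorff_outer_measure_empty [simp]: "hausdorff_outer_measure m {} = 0"
  unfolding hausdorff_outer_measure_def
  by (intro antisym SUP_least) (auto simp: hausdorff_premeasure_empty)

lemma hausdorff_outer_measure_UN:
  "hausdorff_outer_measure m (\<Union>i. A i) \<le> (\<Sum>i::nat. hausdorff_outer_measure m (A i))"
  unfolding hausdorff_outer_measure_def[of m "\<Union>i. A i"]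
  by (intro SUP_least order_trans[OF hausdorff_premeasure_UN] suminf_le hausdorff_premeasure_le_outer) auto

lemma outer_measure_space_hausdorff:
  "outer_measure_space UNIV (hausdorff_outer_measure m)"
  unfolding outer_measure_space_def positive_def increasing_def countably_subadditive_def
  by (auto intro: hausdorff_outer_measure_mono hausdorff_outer_measure_UN)

lemma hausdorff_outer_measure_Un:
  "hausdorff_outer_measure m (A \<union> B) \<le> hausdorff_outer_measure m A + hausdorff_outer_measure m B"
proof -
  have "A \<union> B = (\<Union>i. binaryset A B i)" by (simp add: UN_binaryset_eq)
  also have "hausdorff_outer_measure m \<dots> \<le> (\<Sum>i. hausdorff_outer_measure m (binaryset A B i))"
    by (rule hausdorff_outer_measure_UN)
  also have "\<dots> = hausdorff_outer_measure m A + hausdorff_outer_measure m B"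
    by (intro suminf_binaryset_eq) auto
  finally show ?thesis .
qed

text \<open>
  A covering set of diameter at most \<open>\<delta>\<close> cannot meet two sets that are more than \<open>\<delta>\<close> apart, so any cover
  of the union splits into a cover of each part.
\<close>

lemma hausdorff_premeasure_separated:
  fixes A B :: "'a::metric_space set"
  assumes sep: "\<And>x y. x \<in> A \<Longrightarrow> y \<in> B \<Longrightarrow> \<delta> < dist x y" and "\<delta> \<ge> 0"
  shows "hausdorff_premeasure m \<delta> A + hausdorff_premeasure m \<delta> B \<le> hausdorff_premeasure m \<delta> (A \<union> B)"
  unfolding hausdorff_premeasure_def[of m \<delta> "A \<union> B"]
proof (rule INF_greatest, clarify)
  fix C :: "nat \<Rightarrow> 'a set"
  assume cov: "A \<union> B \<subseteq> (\<Union>i. C i)" and C: "\<forall>i. bounded (C i) \<and> diameter (C i) \<le> \<delta>"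
  define R where "R S i = (if C i \<inter> S = {} then {} else C i)" for S i
  have le: "hausdorff_premeasure m \<delta> S \<le> (\<Sum>i. hausdorff_gauge m (R S i))" if "S \<subseteq> (\<Union>i. C i)" for S
  proof (rule hausdorff_premeasure_le)
    show "S \<subseteq> (\<Union>i. R S i)" using that by (fastforce simp: R_def)
  qed (use C assms in \<open>auto simp: R_def\<close>)
  have "hausdorff_gauge m (R A i) + hausdorff_gauge m (R B i) \<le> hausdorff_gauge m (C i)" for i
  proof -
    have "C i \<inter> A = {} \<or> C i \<inter> B = {}"
      using sep C diameter_bounded_bound[of "C i"] by (meson disjoint_iff le_less_trans not_less order_trans)
    moreover have "hausdorff_gauge m ({}::'a set) = 0" by (simp add: hausdorff_gauge_def)
    ultimately show ?thesis by (auto simp: R_def)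
  qed
  hence "(\<Sum>i. hausdorff_gauge m (R A i) + hausdorff_gauge m (R B i)) \<le> (\<Sum>i. hausdorff_gauge m (C i))"
    by (intro suminf_le) auto
  moreover have "(\<Sum>i. hausdorff_gauge m (R A i) + hausdorff_gauge m (R B i))
      = (\<Sum>i. hausdorff_gauge m (R A i)) + (\<Sum>i. hausdorff_gauge m (R B i))"
    by (intro suminf_add[symmetric]) auto
  ultimately show "hausdorff_premeasure m \<delta> A + hausdorff_premeasure m \<delta> B \<le> (\<Sum>i. hausdorff_gauge m (C i))"
    using add_mono[OF le[of A] le[of B]] cov by (auto intro: order_trans)
qed

lemma hausdorff_outer_measure_separated:
  fixes A B :: "'a::metric_space set"
  assumes sep: "\<And>x y. x \<in> A \<Longrightarrow> y \<in> B \<Longrightarrow> d \<le> dist x y" and d: "d > 0"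
  shows "hausdorff_outer_measure m A + hausdorff_outer_measure m B \<le> hausdorff_outer_measure m (A \<union> B)"
proof -
  have "hausdorff_outer_measure m A + hausdorff_outer_measure m B =
     (SUP \<delta>\<in>{0<..}. hausdorff_premeasure m \<delta> A + hausdorff_premeasure m \<delta> B)"
    unfolding hausdorff_outer_measure_def
  proof (rule SUP_add_directed_ennreal[symmetric])
    fix i j :: real assume ij: "i \<in> {0<..}" "j \<in> {0<..}"
    show "\<exists>k\<in>{0<..}. hausdorff_premeasure m i A + hausdorff_premeasure m j B
        \<le> hausdorff_premeasure m k A + hausdorff_premeasure m k B"
      using ij by (intro bexI[of _ "min i j"] add_mono hausdorff_premeasure_antimono) auto
  qed
  also have "\<dots> \<le> hausdorff_outer_measure m (A \<union> B)"
  proof (rule SUP_least)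
    fix \<delta> :: real assume "\<delta> \<in> {0<..}"
    define k where "k = min \<delta> (d/2)"
    have k: "k > 0" "k \<le> \<delta>" "k < d" using \<open>\<delta> \<in> _\<close> d by (auto simp: k_def)
    have "hausdorff_premeasure m \<delta> A + hausdorff_premeasure m \<delta> B \<le>
        hausdorff_premeasure m k A + hausdorff_premeasure m k B"
      using k by (intro add_mono hausdorff_premeasure_antimono)
    also have "\<dots> \<le> hausdorff_premeasure m k (A \<union> B)"
      using sep k by (intro hausdorff_premeasure_separated) (fastforce intro: less_le_trans)+
    also have "\<dots> \<le> hausdorff_outer_measure m (A \<union> B)"
      using k by (intro hausdorff_premeasure_le_outer)
    finally show "hausdorff_premeasure m \<delta> A + hausdorff_premeasure m \<delta> B \<le> hausdorff_outer_measure m (A \<union> B)" .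
  qed
  finally show ?thesis .
qed

text \<open>
  Caratheodory's criterion. The part of \<open>X\<close> at distance at least \<open>1 / (n + 1)\<close> from \<open>F\<close> is separated from
  \<open>F\<close>, so its measure adds up correctly with that of \<open>F \<inter> X\<close>. What is lost lies in the layers \<open>R k\<close> with \<open>k \<ge> n\<close>.
  Layers of equal parity are separated from each other, so the sum of all their measures is at most twice that of
  \<open>X\<close>, and its tails tend to \<open>0\<close>.
\<close>

lemma closed_in_hausdorff_lambda_system:
  fixes F :: "'a::metric_space set"
  assumes F: "closed F"
  shows "F \<in> lambda_system UNIV UNIV (hausdorff_outer_measure m)"
proof (cases "F = {}")
  case True
  thus ?thesis by (auto simp: lambda_system_def)
next
  case ne: False
  let ?H = "hausdorff_outer_measure m"
  have "?H (F \<inter> X) + ?H (X - F) = ?H X" for X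
  proof (rule antisym)
    show "?H X \<le> ?H (F \<inter> X) + ?H (X - F)"
      using hausdorff_outer_measure_Un[of m "F \<inter> X" "X - F"] by (metis Int_commute Int_Diff_Un)
    show "?H (F \<inter> X) + ?H (X - F) \<le> ?H X"
    proof (cases "?H X = top")
      case fin: False
      define D where "D x = infdist x F" for x
      define Y where "Y n = {x \<in> X. D x \<ge> 1 / real (Suc n)}" for n
      define R where "R n = {x \<in> X. 1 / real (Suc n) > D x \<and> D x \<ge> 1 / real (Suc (Suc n))}" for n
      have Dle: "D x \<le> D y + dist x y" for x y unfolding D_def by (rule infdist_triangle)
      have pos: "D x > 0" if "x \<notin> F" for x
        using that F ne in_closed_iff_infdist_zero[of F x] infdist_nonneg[of x F] by (auto simp: D_def)
      have zero: "D x = 0" if "x \<in> F" for x using that by (simp add: D_def)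
      have a: "?H (F \<inter> X) + ?H (Y n) \<le> ?H X" for n
      proof -
        have "?H (F \<inter> X) + ?H (Y n) \<le> ?H (F \<inter> X \<union> Y n)"
        proof (rule hausdorff_outer_measure_separated)
          fix x y assume "x \<in> F \<inter> X" "y \<in> Y n"
          thus "1 / real (Suc n) \<le> dist x y"
            using Dle[of y x] zero[of x] by (simp add: Y_def dist_commute)
        qed simp
        also have "\<dots> \<le> ?H X" by (intro hausdorff_outer_measure_mono) (auto simp: Y_def)
        finally show ?thesis .
      qed
      have sep: "hausdorff_outer_measure m (R n) + ?H Z \<le> ?H (R n \<union> Z)"
        if Z: "\<And>z. z \<in> Z \<Longrightarrow> z \<in> X \<and> D z < 1 / real (Suc (Suc (Suc n)))" for n Z
      proof -
        define d where "d = 1 / real (Suc (Suc n)) - 1 / real (Suc (Suc (Suc n)))"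
        have "d > 0" unfolding d_def by (simp add: frac_less2)
        show ?thesis
        proof (rule hausdorff_outer_measure_separated)
          fix x y assume xy: "x \<in> R n" "y \<in> Z"
          have "D x \<ge> 1 / real (Suc (Suc n))" using xy by (simp add: R_def)
          moreover have "D y < 1 / real (Suc (Suc (Suc n)))" using Z xy by blast
          ultimately show "d \<le> dist x y" using Dle[of x y] unfolding d_def by linarith
        qed fact
      qed
      \<comment> \<open>the layers of one parity, split off one after the other from the outermost inwards\<close>
      have step: "(\<Sum>k<n. ?H (R (2*k+p))) \<le> ?H X" for n p
      proof -
        have "(\<Sum>k<n. ?H (R (2*(k+j)+p))) \<le> ?H {x\<in>X. D x < 1 / real (Suc (2*j+p))}" for j
        proof (induction n arbitrary: j)
          case (Suc n)
          have "(\<Sum>k<Suc n. ?H (R (2*(k+j)+p))) = ?H (R (2*j+p)) + (\<Sum>k<n. ?H (R (2*(k+Suc j)+p)))"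
            by (subst sum.lessThan_Suc_shift) simp
          also have "\<dots> \<le> ?H (R (2*j+p)) + ?H {x\<in>X. D x < 1 / real (Suc (2*Suc j+p))}"
            by (intro add_left_mono Suc)
          also have "\<dots> \<le> ?H (R (2*j+p) \<union> {x\<in>X. D x < 1 / real (Suc (2*Suc j+p))})"
            by (intro sep) auto
          also have "\<dots> \<le> ?H {x\<in>X. D x < 1 / real (Suc (2*j+p))}"
          proof (intro hausdorff_outer_measure_mono, safe)
            fix x assume "D x < 1 / real (Suc (2*Suc j+p))"
            also have "\<dots> \<le> 1 / real (Suc (2*j+p))" by (intro divide_left_mono) auto
            finally show "D x < 1 / real (Suc (2*j+p))" .
          qed (auto simp: R_def)
          finally show ?case .
        qed simp
        from this[of 0] show ?thesis
          by (simp) (erule order_trans, intro hausdorff_outer_measure_mono, auto)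
      qed
      have sumR: "(\<Sum>n. ?H (R n)) < top"
      proof -
        have "(\<Sum>k<n. ?H (R k)) \<le> ?H X + ?H X" for n
        proof -
          have "(\<Sum>k<n. ?H (R k)) \<le> (\<Sum>k<2*n. ?H (R k))" by (intro sum_mono2) auto
          also have "\<dots> = (\<Sum>k<n. ?H (R (2*k+0))) + (\<Sum>k<n. ?H (R (2*k+1)))"
            by (induction n) (auto simp: algebra_simps)
          also have "\<dots> \<le> ?H X + ?H X" by (intro add_mono step)
          finally show ?thesis .
        qed
        hence "(\<Sum>n. ?H (R n)) \<le> ?H X + ?H X" by (simp add: suminf_eq_SUP SUP_least)
        also have "\<dots> < top" using fin by (simp add: less_top)
        finally show ?thesis .
      qed
      have tail: "?H (X - F) \<le> ?H (Y n) + (\<Sum>k. ?H (R (k + n)))" for n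
      proof -
        have "X - F \<subseteq> Y n \<union> (\<Union>k. R (k + n))"
        proof
          fix x assume x: "x \<in> X - F"
          show "x \<in> Y n \<union> (\<Union>k. R (k + n))"
          proof (cases "x \<in> Y n")
            case False
            obtain k where "1 / real (Suc k) < D x"
              using pos[of x] x reals_Archimedean[of "D x"] by (auto simp: inverse_eq_divide)
            hence ex: "\<exists>k. 1 / real (Suc k) \<le> D x" by (intro exI[of _ k]) simp
            define l where "l = (LEAST k. 1 / real (Suc k) \<le> D x)"
            have l: "1 / real (Suc l) \<le> D x" unfolding l_def by (rule LeastI_ex[OF ex])
            have ln: "n < l"
            proof (rule ccontr)
              assume "\<not> n < l"
              hence "1 / real (Suc n) \<le> 1 / real (Suc l)" by (simp add: field_simps)
              thus False using l False x by (auto simp: Y_def)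
            qed
            have "\<not> 1 / real (Suc (l-1)) \<le> D x"
              using ln unfolding l_def by (intro not_less_Least) auto
            hence "x \<in> R (l-1)" using l ln x by (auto simp: R_def)
            moreover have "l - 1 = (l - 1 - n) + n" using ln by simp
            ultimately show ?thesis by (metis UN_iff UNIV_I UnI2)
          qed simp
        qed
        hence "?H (X - F) \<le> ?H (Y n \<union> (\<Union>k. R (k + n)))" by (rule hausdorff_outer_measure_mono)
        also have "\<dots> \<le> ?H (Y n) + ?H (\<Union>k. R (k + n))" by (rule hausdorff_outer_measure_Un)
        also have "\<dots> \<le> ?H (Y n) + (\<Sum>k. ?H (R (k + n)))"
          by (intro add_left_mono hausdorff_outer_measure_UN)
        finally show ?thesis .
      qed
      show ?thesis
      proof (rule ennreal_le_epsilon)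
        fix e :: real assume "e > 0"
        have finR: "ennreal (enn2real (?H (R n))) = ?H (R n)" for n
          using ennreal_suminf_lessD[OF sumR, of n] by simp
        have summ: "summable (\<lambda>n. enn2real (?H (R n)))"
          by (rule summable_suminf_not_top) (use sumR finR in auto)
        hence "(\<lambda>n. \<Sum>k. enn2real (?H (R (k + n)))) \<longlonglongrightarrow> 0"
          by (rule suminf_exist_split2)
        hence "eventually (\<lambda>n. (\<Sum>k. enn2real (?H (R (k + n)))) < e) sequentially"
          using \<open>e > 0\<close> by (rule order_tendstoD)
        then obtain n where n: "(\<Sum>k. enn2real (?H (R (k + n)))) < e"
          by (auto simp: eventually_sequentially)
        have "(\<Sum>k. ?H (R (k + n))) = ennreal (\<Sum>k. enn2real (?H (R (k + n))))"
          using suminf_ennreal2[OF _ summable_ignore_initial_segment[OF summ, of n]] finR by simp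
        hence "(\<Sum>k. ?H (R (k + n))) \<le> ennreal e" using n by (simp add: ennreal_leI)
        hence "?H (F \<inter> X) + ?H (X - F) \<le> ?H (F \<inter> X) + (?H (Y n) + ennreal e)"
          using tail[of n] by (intro add_left_mono) (auto intro: order_trans add_left_mono)
        also have "\<dots> \<le> ?H X + ennreal e"
          using a[of n] by (metis add.assoc add_right_mono)
        finally show "?H (F \<inter> X) + ?H (X - F) \<le> ?H X + ennreal e" .
      qed
    qed simp
  qed
  thus ?thesis by (auto simp: lambda_system_def Diff_eq Int_commute)
qed

lemma sets_hausdorff_measure [simp, measurable_cong]: "sets (hausdorff_measure m) = sets borel"
  by (simp add: hausdorff_measure_def sets.sigma_sets_eq[of borel, simplified])

lemma space_hausdorff_measure [simp]: "space (hausdorff_measure m) = UNIV"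
  by (simp add: hausdorff_measure_def)

lemma emeasure_hausdorff_measure:
  assumes "A \<in> sets borel"
  shows "emeasure (hausdorff_measure m) A = hausdorff_outer_measure m A"
proof -
  interpret P: sigma_algebra "UNIV::'a set" "UNIV" by (rule sigma_algebra_Pow[of UNIV, simplified])
  let ?L = "lambda_system UNIV UNIV (hausdorff_outer_measure m :: 'a set \<Rightarrow> ennreal)"
  have ms: "measure_space UNIV ?L (hausdorff_outer_measure m)"
    by (rule P.caratheodory_lemma[OF outer_measure_space_hausdorff])
  hence "sigma_algebra UNIV ?L" by (simp add: measure_space_def)
  moreover have "Collect closed \<subseteq> ?L" using closed_in_hausdorff_lambda_system by blast
  ultimately have "sigma_sets UNIV (Collect closed) \<subseteq> ?L"
    by (rule sigma_algebra.sigma_sets_subset)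
  hence sub: "sets (borel :: 'a measure) \<subseteq> ?L"
    by (simp add: borel_eq_closed)
  have "countably_additive ?L (hausdorff_outer_measure m)" "positive ?L (hausdorff_outer_measure m)"
    using ms by (auto simp: measure_space_def)
  hence "countably_additive (sets borel) (hausdorff_outer_measure m :: 'a set \<Rightarrow> ennreal)"
    "positive (sets borel) (hausdorff_outer_measure m:: 'a set \<Rightarrow> ennreal)"
    using sub unfolding countably_additive_def positive_def by blast+
  thus ?thesis
    unfolding hausdorff_measure_def using assms
    by (intro emeasure_measure_of_sigma) (auto simp: sets.sigma_algebra_axioms[of borel, simplified])
qed

text \<open>
  The images of the covering sets cover the image, and their diameters grow by at most the factor \<open>L\<close>.
\<close>

lemma hausdorff_outer_measure_lipschitz_image:
  fixes \<psi> :: "'a::metric_space \<Rightarrow> 'b::metric_space"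
  assumes lip: "\<And>x y. x \<in> S \<Longrightarrow> y \<in> S \<Longrightarrow> dist (\<psi> x) (\<psi> y) \<le> L * dist x y" and L: "L > 0"
  shows "hausdorff_outer_measure m (\<psi> ` S) \<le> ennreal (L ^ m) * hausdorff_outer_measure m S"
  unfolding hausdorff_outer_measure_def[of m "\<psi> ` S"]
proof (rule SUP_least)
  fix \<delta> :: real assume "\<delta> \<in> {0<..}"
  hence \<delta>: "\<delta> > 0" by simp
  have "hausdorff_premeasure m \<delta> (\<psi> ` S) / ennreal (L ^ m) \<le> hausdorff_premeasure m (\<delta> / L) S"
    unfolding hausdorff_premeasure_def[of m "\<delta> / L"]
  proof (rule INF_greatest, clarify)
    fix C :: "nat \<Rightarrow> 'a set"
    assume cov: "S \<subseteq> (\<Union>i. C i)" and C: "\<forall>i. bounded (C i) \<and> diameter (C i) \<le> \<delta> / L"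
    define E where "E i = \<psi> ` (C i \<inter> S)" for i
    have dist_E: "dist x y \<le> L * diameter (C i)" if "x \<in> E i" "y \<in> E i" for x y i
      using that C diameter_bounded_bound[of "C i"] L
      by (auto simp: E_def intro!: order_trans[OF lip] mult_left_mono)
    have bE: "bounded (E i)" for i
    proof (cases "E i = {}")
      case False
      then obtain x where "x \<in> E i" by blast
      thus ?thesis using dist_E[of x i] unfolding bounded_def by blast
    qed simp
    have dE: "diameter (E i) \<le> L * diameter (C i)" for i
      using dist_E[of _ i] L C diameter_ge_0[of "C i"]
      unfolding diameter_def[of "E i"] by (auto intro!: cSUP_least)
    have "hausdorff_premeasure m \<delta> (\<psi> ` S) \<le> (\<Sum>i. hausdorff_gauge m (E i))"
    proof (rule hausdorff_premeasure_le)
      show "\<psi> ` S \<subseteq> (\<Union>i. E i)" using cov by (fastforce simp: E_def)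
      show "diameter (E i) \<le> \<delta>" for i
      proof -
        have "L * diameter (C i) \<le> L * (\<delta> / L)" using C L by (intro mult_left_mono) auto
        thus ?thesis using dE[of i] L by simp
      qed
    qed (rule bE)
    also have "\<dots> \<le> (\<Sum>i. ennreal (L ^ m) * hausdorff_gauge m (C i))"
    proof (intro suminf_le summableI)
      fix i
      have "0 \<le> diameter (E i)" using bE by (rule diameter_ge_0)
      hence "(diameter (E i) / 2) ^ m \<le> (L * diameter (C i) / 2) ^ m"
        using dE[of i] by (intro power_mono) auto
      also have "\<dots> = L ^ m * (diameter (C i) / 2) ^ m" by (simp add: power_mult_distrib[symmetric])
      finally have "unit_ball_vol (real m) * (diameter (E i) / 2) ^ m \<le>
          L ^ m * (unit_ball_vol (real m) * (diameter (C i) / 2) ^ m)"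
        using mult_left_mono[of _ _ "unit_ball_vol (real m)"] by (fastforce simp: mult_ac)
      moreover have "C i \<noteq> {}" if "E i \<noteq> {}" using that by (auto simp: E_def)
      ultimately show "hausdorff_gauge m (E i) \<le> ennreal (L ^ m) * hausdorff_gauge m (C i)"
        using L by (auto simp: hausdorff_gauge_def ennreal_mult'[symmetric] intro!: ennreal_leI)
    qed
    also have "\<dots> = ennreal (L ^ m) * (\<Sum>i. hausdorff_gauge m (C i))" by simp
    finally show "hausdorff_premeasure m \<delta> (\<psi> ` S) / ennreal (L ^ m) \<le> (\<Sum>i. hausdorff_gauge m (C i))"
      using L by (subst divide_le_posI_ennreal) (auto simp: mult.commute)
  qed
  also have "\<dots> \<le> hausdorff_outer_measure m S"
    using \<delta> L by (intro hausdorff_premeasure_le_outer) auto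
  finally have "hausdorff_premeasure m \<delta> (\<psi> ` S) / ennreal (L ^ m) * ennreal (L ^ m)
      \<le> hausdorff_outer_measure m S * ennreal (L ^ m)"
    by (rule mult_right_mono) simp
  moreover have "hausdorff_premeasure m \<delta> (\<psi> ` S) / ennreal (L ^ m) * ennreal (L ^ m)
      = hausdorff_premeasure m \<delta> (\<psi> ` S)"
    using L by (subst ennreal_divide_times, subst ennreal_divide_self) auto
  ultimately show "hausdorff_premeasure m \<delta> (\<psi> ` S) \<le> ennreal (L ^ m) * hausdorff_outer_measure m S"
    by (simp only: mult.commute)
qed

section \<open>Flat discs have positive finite measure\<close>

text \<open>
  The lower bound for the measure of a disc comes from the volume of the cylinder over it: the cylinder of
  height \<open>1\<close> over a set of diameter \<open>\<eta>\<close> is covered by about \<open>1 / \<eta>\<close> balls of radius \<open>2 * \<eta>\<close>, so its volume is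
  of order \<open>\<eta> ^ (N - 1)\<close>, the gauge of the base.
\<close>

lemma tube_cover:
  fixes C :: "'a::euclidean_space set"
  assumes w: "norm w = 1" and C: "bounded C" "diameter C \<le> \<eta>" and \<eta>: "0 < \<eta>" "\<eta> \<le> 1"
  shows "\<exists>V\<in>sets borel. (\<forall>x\<in>C. \<forall>s\<in>{0..1}. x + s *\<^sub>R w \<in> V) \<and>
     emeasure lborel V \<le> ennreal (3 * 2 ^ DIM('a) * unit_ball_vol (real DIM('a)) * \<eta> ^ (DIM('a) - 1))"
proof (cases "C = {}")
  case True
  thus ?thesis by (intro bexI[of _ "{}"]) auto
next
  case False
  then obtain c where c: "c \<in> C" by blast
  let ?u = "unit_ball_vol (real DIM('a))"
  define n where "n = nat \<lceil>1/\<eta>\<rceil>"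
  define V where "V = (\<Union>j\<in>{..n}. cball (c + (real j * \<eta>) *\<^sub>R w) (2 * \<eta>))"
  have "x + s *\<^sub>R w \<in> V" if x: "x \<in> C" and s: "s \<in> {0..1}" for x s
  proof -
    define j where "j = nat \<lfloor>s / \<eta>\<rfloor>"
    have s0: "s / \<eta> \<ge> 0" using s \<eta> by simp
    have "s / \<eta> \<le> 1 / \<eta>" using s \<eta> by (simp add: divide_right_mono)
    hence "j \<le> n" unfolding j_def n_def by linarith
    moreover have "real j = \<lfloor>s / \<eta>\<rfloor>" using s0 by (simp add: j_def)
    hence "\<bar>s / \<eta> - real j\<bar> \<le> 1" by linarith
    hence "\<bar>s - real j * \<eta>\<bar> \<le> \<eta>" using \<eta> by (simp add: abs_le_iff field_simps)
    hence "norm ((s - real j * \<eta>) *\<^sub>R w) \<le> \<eta>" using w by simp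
    moreover have "norm (x - c) \<le> \<eta>"
      using diameter_bounded_bound[OF C(1) x c] C(2) by (simp add: dist_norm)
    ultimately have "norm ((x - c) + (s - real j * \<eta>) *\<^sub>R w) \<le> 2 * \<eta>"
      using norm_triangle_ineq[of "x - c" "(s - real j * \<eta>) *\<^sub>R w"] by linarith
    moreover have "x + s *\<^sub>R w - (c + (real j * \<eta>) *\<^sub>R w) = (x - c) + (s - real j * \<eta>) *\<^sub>R w"
      by (simp add: algebra_simps)
    ultimately have "dist (x + s *\<^sub>R w) (c + (real j * \<eta>) *\<^sub>R w) \<le> 2 * \<eta>"
      by (simp only: dist_norm)
    hence "x + s *\<^sub>R w \<in> cball (c + (real j * \<eta>) *\<^sub>R w) (2 * \<eta>)"
      by (simp only: mem_cball dist_commute)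
    thus ?thesis using \<open>j \<le> n\<close> by (auto simp: V_def)
  qed
  moreover have "V \<in> sets borel" by (auto simp: V_def)
  moreover have "emeasure lborel V \<le> ennreal (3 * 2 ^ DIM('a) * ?u * \<eta> ^ (DIM('a) - 1))"
  proof -
    have "emeasure lborel V \<le> (\<Sum>j\<in>{..n}. emeasure lborel (cball (c + (real j * \<eta>) *\<^sub>R w) (2 * \<eta>)))"
      unfolding V_def by (intro emeasure_subadditive_finite) auto
    also have "\<dots> = ennreal (real (n + 1) * (?u * (2 * \<eta>) ^ DIM('a)))"
      using \<eta> by (simp add: emeasure_cball ennreal_mult ennreal_of_nat_eq_real_of_nat add.commute)
    also have "\<dots> \<le> ennreal (3 / \<eta> * (?u * (2 * \<eta>) ^ DIM('a)))"
    proof (intro ennreal_leI mult_right_mono)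
      have "1 / \<eta> \<ge> 1" using \<eta> by simp
      moreover have "real n \<le> 1 / \<eta> + 1" unfolding n_def using \<open>1 / \<eta> \<ge> 1\<close> by linarith
      ultimately have "real (n + 1) \<le> 3 * (1 / \<eta>)" by simp
      thus "real (n + 1) \<le> 3 / \<eta>" by simp
    qed (use \<eta> in auto)
    also have "3 / \<eta> * (?u * (2 * \<eta>) ^ DIM('a)) = 3 * 2 ^ DIM('a) * ?u * \<eta> ^ (DIM('a) - 1)"
      using \<eta> DIM_positive[where 'a='a] by (cases "DIM('a)") (auto simp: power_mult_distrib)
    finally show ?thesis .
  qed
  ultimately show ?thesis by blast
qed

text \<open>
  For a base of diameter \<open>0\<close> the gauge vanishes, because the dimension \<open>N - 1\<close> is positive, and the volume
  bound is then obtained by letting \<open>\<eta>\<close> tend to \<open>0\<close>.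
\<close>

lemma tube_cover_gauge:
  assumes "2 \<le> DIM('a::euclidean_space)"
  obtains K where "K > 0" "\<And>C (w::'a). norm w = 1 \<Longrightarrow> bounded C \<Longrightarrow> diameter C \<le> 1 \<Longrightarrow>
     \<exists>V\<in>sets borel. (\<forall>x\<in>C. \<forall>s\<in>{0..1}. x + s *\<^sub>R w \<in> V) \<and>
     emeasure lborel V \<le> ennreal K * hausdorff_gauge (DIM('a) - 1) C"
proof -
  define m where "m = DIM('a) - 1"
  have m: "m \<ge> 1" using assms by (simp add: m_def)
  define K0 where "K0 = 3 * 2 ^ DIM('a) * unit_ball_vol (real DIM('a))"
  have K0: "K0 > 0" by (simp add: K0_def)
  define K where "K = K0 * 2 ^ m / unit_ball_vol (real m)"
  have K: "K > 0" using K0 by (simp add: K_def)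
  have "\<exists>V\<in>sets borel. (\<forall>x\<in>C. \<forall>s\<in>{0..1}. x + s *\<^sub>R w \<in> V) \<and> emeasure lborel V \<le> ennreal K * hausdorff_gauge m C"
    if w: "norm w = 1" and C: "bounded C" "diameter C \<le> 1" for C and w :: 'a
  proof (cases "C = {}")
    case True
    thus ?thesis by (intro bexI[of _ "{}"]) auto
  next
    case ne: False
    show ?thesis
    proof (cases "diameter C = 0")
      case False
      hence d: "diameter C > 0" using diameter_ge_0[OF C(1)] by simp
      have "ennreal K * hausdorff_gauge m C = ennreal (K * (unit_ball_vol (real m) * (diameter C / 2) ^ m))"
        using ne K by (simp add: hausdorff_gauge_def ennreal_mult')
      also have "K * (unit_ball_vol (real m) * (diameter C / 2) ^ m) = K0 * diameter C ^ m"
        by (simp add: K_def power_divide less_imp_neq[symmetric])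
      finally show ?thesis using tube_cover[OF w C(1) order.refl d C(2)] by (simp add: K0_def m_def)
    next
      case True
      have "\<forall>n. \<exists>V\<in>sets borel. (\<forall>x\<in>C. \<forall>s\<in>{0..1}. x + s *\<^sub>R w \<in> V) \<and>
          emeasure lborel V \<le> ennreal (K0 * (1 / real (Suc n)) ^ m)"
        using tube_cover[OF w C(1)] True unfolding K0_def m_def by simp
      then obtain V where V: "\<And>n. V n \<in> sets borel" "\<And>n x s. x \<in> C \<Longrightarrow> s \<in> {0..1} \<Longrightarrow> x + s *\<^sub>R w \<in> V n"
          "\<And>n. emeasure lborel (V n) \<le> ennreal (K0 * (1 / real (Suc n)) ^ m)"
        by metis
      have "emeasure lborel (\<Inter>n. V n) \<le> 0"
      proof (rule ennreal_le_epsilon)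
        fix e :: real assume "e > 0"
        then obtain n where n: "inverse (real (Suc n)) < e / K0"
          using reals_Archimedean[of "e / K0"] K0 by auto
        have "(1 / real (Suc n)) ^ m \<le> 1 / real (Suc n)"
          using power_decreasing[of 1 m "1 / real (Suc n)"] m by simp
        hence "K0 * (1 / real (Suc n)) ^ m \<le> K0 * (e / K0)"
          using n K0 by (intro mult_left_mono) (auto simp: inverse_eq_divide)
        hence "ennreal (K0 * (1 / real (Suc n)) ^ m) \<le> ennreal e"
          using K0 by (intro ennreal_leI) simp
        moreover have "emeasure lborel (\<Inter>n. V n) \<le> emeasure lborel (V n)"
          using V(1) by (intro emeasure_mono) auto
        ultimately show "emeasure lborel (\<Inter>n. V n) \<le> 0 + ennreal e"
          using V(3)[of n] by simp
      qed
      thus ?thesis using V by (intro bexI[of _ "\<Inter>n. V n"]) auto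
    qed
  qed
  thus thesis using K by (intro that[of K]) (auto simp: m_def)
qed

lemma hausdorff_disc_pos:
  fixes w :: "'a::euclidean_space"
  assumes dim: "2 \<le> DIM('a)" and w: "norm w = 1" and t: "t > 0"
  shows "hausdorff_outer_measure (DIM('a) - 1) {x. x \<bullet> w = 0 \<and> norm x < t} > 0"
proof -
  let ?D = "{x. x \<bullet> w = 0 \<and> norm x < t}"
  define m where "m = DIM('a) - 1"
  obtain K where K: "K > 0" and cov: "\<And>C (w::'a). norm w = 1 \<Longrightarrow> bounded C \<Longrightarrow> diameter C \<le> 1 \<Longrightarrow>
     \<exists>V\<in>sets borel. (\<forall>x\<in>C. \<forall>s\<in>{0..1}. x + s *\<^sub>R w \<in> V) \<and>
     emeasure lborel V \<le> ennreal K * hausdorff_gauge m C"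
    using tube_cover_gauge[OF dim] unfolding m_def by blast
  \<comment> \<open>a ball contained in the cylinder of height \<open>1\<close> over the disc\<close>
  define T where "T = ball ((1/2) *\<^sub>R w) (min t (1/2))"
  have ww: "w \<bullet> w = 1" using w by (simp add: norm_eq_1)
  have T: "y - (y \<bullet> w) *\<^sub>R w \<in> ?D" "y \<bullet> w \<in> {0..1}" if "y \<in> T" for y
  proof -
    define z where "z = y - (1/2) *\<^sub>R w"
    have z: "norm z < t" "norm z < 1/2" using that by (auto simp: T_def z_def dist_norm norm_minus_commute)
    have "\<bar>z \<bullet> w\<bar> \<le> norm z" using Cauchy_Schwarz_ineq2[of z w] w by simp
    thus "y \<bullet> w \<in> {0..1}" using z ww by (auto simp: z_def inner_diff_left)
    have "norm (z - (z \<bullet> w) *\<^sub>R w) \<le> norm z"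
      unfolding norm_le by (simp add: algebra_simps inner_commute[of w z] ww power2_eq_square[symmetric])
    moreover have "z - (z \<bullet> w) *\<^sub>R w = y - (y \<bullet> w) *\<^sub>R w"
      by (simp add: z_def algebra_simps ww)
    ultimately show "y - (y \<bullet> w) *\<^sub>R w \<in> ?D"
      using z by (simp add: inner_diff_left ww)
  qed
  have "emeasure lborel T / ennreal K \<le> hausdorff_premeasure m 1 ?D"
    unfolding hausdorff_premeasure_def
  proof (rule INF_greatest, clarify)
    fix C :: "nat \<Rightarrow> 'a set"
    assume C: "?D \<subseteq> (\<Union>i. C i)" "\<forall>i. bounded (C i) \<and> diameter (C i) \<le> 1"
    have "\<forall>i. \<exists>V\<in>sets borel. (\<forall>x\<in>C i. \<forall>s\<in>{0..1}. x + s *\<^sub>R w \<in> V) \<and>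
     emeasure lborel V \<le> ennreal K * hausdorff_gauge m (C i)"
      using cov[OF w] C(2) by blast
    then obtain V where V: "\<And>i. V i \<in> sets borel" "\<And>i x s. x \<in> C i \<Longrightarrow> s \<in> {0..1} \<Longrightarrow> x + s *\<^sub>R w \<in> V i"
       "\<And>i. emeasure lborel (V i) \<le> ennreal K * hausdorff_gauge m (C i)"
      by metis
    have "T \<subseteq> (\<Union>i. V i)"
    proof
      fix y assume y: "y \<in> T"
      then obtain i where "y - (y \<bullet> w) *\<^sub>R w \<in> C i" using T(1) C(1) by blast
      hence "(y - (y \<bullet> w) *\<^sub>R w) + (y \<bullet> w) *\<^sub>R w \<in> V i" using T(2)[OF y] by (rule V(2))
      thus "y \<in> (\<Union>i. V i)" by auto
    qed
    hence "emeasure lborel T \<le> emeasure lborel (\<Union>i. V i)"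
      using V(1) by (intro emeasure_mono) auto
    also have "\<dots> \<le> (\<Sum>i. emeasure lborel (V i))"
      using V(1) by (intro emeasure_subadditive_countably) auto
    also have "\<dots> \<le> (\<Sum>i. ennreal K * hausdorff_gauge m (C i))"
      using V(3) by (intro suminf_le) auto
    also have "\<dots> = ennreal K * (\<Sum>i. hausdorff_gauge m (C i))" by simp
    finally show "emeasure lborel T / ennreal K \<le> (\<Sum>i. hausdorff_gauge m (C i))"
      using K by (intro divide_le_posI_ennreal) auto
  qed
  also have "\<dots> \<le> hausdorff_outer_measure m ?D" by (rule hausdorff_premeasure_le_outer) simp
  finally have "emeasure lborel T / ennreal K \<le> hausdorff_outer_measure m ?D" .
  moreover have "emeasure lborel T / ennreal K > 0"
    using t by (simp add: T_def emeasure_ball ennreal_zero_less_divide)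
  ultimately show ?thesis
    unfolding m_def by (rule less_le_trans[rotated])
qed

lemma hausdorff_premeasure_finite_cover:
  fixes C :: "'i \<Rightarrow> 'a::metric_space set"
  assumes "finite I" "A \<subseteq> (\<Union>i\<in>I. C i)" "\<And>i. i \<in> I \<Longrightarrow> bounded (C i)" "\<And>i. i \<in> I \<Longrightarrow> diameter (C i) \<le> \<delta>" "\<delta> \<ge> 0"
  shows "hausdorff_premeasure m \<delta> A \<le> (\<Sum>i\<in>I. hausdorff_gauge m (C i))"
proof -
  obtain h where h: "bij_betw h {..<card I} I"
    using ex_bij_betw_nat_finite[OF assms(1)] by (auto simp: atLeast0LessThan)
  define E where "E j = (if j < card I then C (h j) else {})" for j
  have hI: "h j \<in> I" if "j < card I" for j using h that by (auto simp: bij_betw_def)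
  have "hausdorff_premeasure m \<delta> A \<le> (\<Sum>j. hausdorff_gauge m (E j))"
  proof (rule hausdorff_premeasure_le)
    show "A \<subseteq> (\<Union>j. E j)"
    proof
      fix x assume "x \<in> A"
      then obtain i where i: "i \<in> I" "x \<in> C i" using assms(2) by blast
      then obtain j where "j < card I" "h j = i"
        using h by (metis bij_betw_imp_surj_on imageE lessThan_iff)
      thus "x \<in> (\<Union>j. E j)" using i by (auto simp: E_def intro!: exI[of _ j])
    qed
  qed (use assms hI in \<open>auto simp: E_def\<close>)
  also have "\<dots> = (\<Sum>j<card I. hausdorff_gauge m (E j))"
    by (intro suminf_finite) (auto simp: E_def hausdorff_gauge_def)
  also have "\<dots> = (\<Sum>j<card I. hausdorff_gauge m (C (h j)))" by (intro sum.cong) (auto simp: E_def)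
  also have "\<dots> = (\<Sum>i\<in>I. hausdorff_gauge m (C i))"
    by (rule sum.reindex_bij_betw[OF h])
  finally show ?thesis .
qed

text \<open>
  Cut the face into \<open>n ^ (N - 1)\<close> cubes of side \<open>2 * R / n\<close>. Their gauges add up to a number that does not depend on
  \<open>n\<close>.
\<close>

lemma hausdorff_coordinate_face_finite:
  fixes k :: "'a::euclidean_space"
  assumes k: "k \<in> Basis" and R: "R > 0"
  shows "hausdorff_outer_measure (DIM('a) - 1) {x. x \<bullet> k = 0 \<and> (\<forall>b\<in>Basis. \<bar>x \<bullet> b\<bar> \<le> R)} < \<infinity>"
proof -
  define m where "m = DIM('a) - 1"
  define N where "N = real DIM('a)"
  define B where "B = Basis - {k}"
  have B: "finite B" "card B = m" using k by (auto simp: B_def m_def)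
  let ?Q = "{x. x \<bullet> k = 0 \<and> (\<forall>b\<in>Basis. \<bar>x \<bullet> b\<bar> \<le> R)}"
  have N: "N > 0" by (simp add: N_def)
  have "hausdorff_premeasure m \<delta> ?Q \<le> ennreal (unit_ball_vol (real m) * (N * R) ^ m)" if \<delta>: "\<delta> > 0" for \<delta>
  proof -
    obtain n0 where n0: "N * (2 * R) / \<delta> < real n0" using reals_Archimedean2 by blast
    define n where "n = Suc n0"
    have n: "N * (2 * R / real n) \<le> \<delta>" "n > 0"
      using n0 \<delta> by (auto simp: n_def field_simps)
    define I where "I = (B \<rightarrow>\<^sub>E {..<n})"
    define C where "C i = {x. x \<bullet> k = 0 \<and> (\<forall>b\<in>B. - R + 2 * R * real (i b) / n \<le> x \<bullet> b \<and> x \<bullet> b \<le> - R + 2 * R * (real (i b) + 1) / n)}" for i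
    have fI: "finite I" "card I = n ^ m" using B by (auto simp: I_def card_PiE finite_PiE)
    have nd: "norm (x - y) \<le> N * (2 * R / n)" if "x \<in> C i" "y \<in> C i" for x y i
    proof -
      have "\<bar>(x - y) \<bullet> b\<bar> \<le> 2 * R / n" if b: "b \<in> Basis" for b
      proof (cases "b = k")
        case False
        hence "b \<in> B" using b by (simp add: B_def)
        hence "- R + 2 * R * real (i b) / n \<le> x \<bullet> b \<and> x \<bullet> b \<le> - R + 2 * R * real (i b) / n + 2 * R / n"
           "- R + 2 * R * real (i b) / n \<le> y \<bullet> b \<and> y \<bullet> b \<le> - R + 2 * R * real (i b) / n + 2 * R / n"
          using \<open>x \<in> C i\<close> \<open>y \<in> C i\<close> by (auto simp: C_def add_divide_distrib distrib_left)
        thus ?thesis by (auto simp: inner_diff_left abs_le_iff)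
      qed (use \<open>x \<in> C i\<close> \<open>y \<in> C i\<close> R in \<open>auto simp: C_def inner_diff_left\<close>)
      hence "(\<Sum>b\<in>Basis. \<bar>(x - y) \<bullet> b\<bar>) \<le> (\<Sum>b\<in>(Basis::'a set). 2 * R / n)" by (rule sum_mono)
      thus ?thesis using norm_le_l1[of "x - y"] by (simp add: N_def)
    qed
    have bC: "bounded (C i)" for i
    proof (cases "C i = {}")
      case False
      then obtain x where "x \<in> C i" by blast
      thus ?thesis using nd[of x i] unfolding bounded_def dist_norm by blast
    qed simp
    have dC: "diameter (C i) \<le> N * (2 * R / n)" for i
      using nd N R by (intro diameter_le) auto
    have "hausdorff_premeasure m \<delta> ?Q \<le> (\<Sum>i\<in>I. hausdorff_gauge m (C i))"
    proof (rule hausdorff_premeasure_finite_cover)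
      show "?Q \<subseteq> (\<Union>i\<in>I. C i)"
      proof
        fix x assume x: "x \<in> ?Q"
        define q where "q b = (x \<bullet> b + R) / (2 * R) * n" for b
        \<comment> \<open>the points with \<open>x \<bullet> b = R\<close> go to the last cube\<close>
        define i where "i = restrict (\<lambda>b. if q b = n then n - 1 else nat \<lfloor>q b\<rfloor>) B"
        have i: "i b < n \<and> real (i b) \<le> q b \<and> q b \<le> real (i b) + 1" if b: "b \<in> B" for b
        proof -
          have xb: "-R \<le> x \<bullet> b" "x \<bullet> b \<le> R" using x b by (auto simp: B_def abs_le_iff)
          have q0: "0 \<le> q b" using xb R n by (simp add: q_def)
          have "(x \<bullet> b + R) / (2 * R) \<le> 1" using xb R by simp
          from mult_right_mono[OF this, of "real n"] have q1: "q b \<le> n" by (simp add: q_def)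
          show ?thesis
          proof (cases "q b = n")
            case True
            thus ?thesis using n(2) b by (simp add: i_def of_nat_diff)
          next
            case False
            hence "q b < n" using q1 by simp
            hence "nat \<lfloor>q b\<rfloor> < n" using q0 by linarith
            moreover have "real (nat \<lfloor>q b\<rfloor>) \<le> q b" "q b \<le> real (nat \<lfloor>q b\<rfloor>) + 1" using q0 by linarith+
            ultimately show ?thesis using b False by (simp add: i_def)
          qed
        qed
        have "i \<in> I" using i by (auto simp: I_def i_def restrict_def split: if_splits)
        moreover have "x \<in> C i"
        proof -
          have xq: "x \<bullet> b = - R + 2 * R * q b / n" for b using R n(2) by (simp add: q_def)
          have "- R + 2 * R * real (i b) / n \<le> x \<bullet> b \<and> x \<bullet> b \<le> - R + 2 * R * (real (i b) + 1) / n" if "b \<in> B" for b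
            unfolding xq using i[OF that] R n(2) by (intro conjI add_left_mono divide_right_mono mult_left_mono) auto
          thus ?thesis using x by (simp add: C_def)
        qed
        ultimately show "x \<in> (\<Union>i\<in>I. C i)" by blast
      qed
      show "diameter (C i) \<le> \<delta>" for i using dC[of i] n(1) by simp
    qed (use fI bC \<delta> in auto)
    also have "\<dots> \<le> (\<Sum>i\<in>I. ennreal (unit_ball_vol (real m) * (N * R / n) ^ m))"
    proof (rule sum_mono)
      fix i
      have "(diameter (C i) / 2) ^ m \<le> (N * R / n) ^ m"
        using dC[of i] diameter_ge_0[OF bC, of i] by (intro power_mono) (auto simp: mult_ac)
      thus "hausdorff_gauge m (C i) \<le> ennreal (unit_ball_vol (real m) * (N * R / n) ^ m)"
        by (auto simp: hausdorff_gauge_def intro!: ennreal_leI mult_left_mono)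
    qed
    also have "\<dots> = ennreal (real (n ^ m) * (unit_ball_vol (real m) * (N * R / n) ^ m))"
      using N R by (simp add: fI ennreal_of_nat_eq_real_of_nat ennreal_mult)
    also have "real (n ^ m) * (unit_ball_vol (real m) * (N * R / n) ^ m) = unit_ball_vol (real m) * (N * R) ^ m"
      using n(2) by (simp add: power_divide)
    finally show ?thesis .
  qed
  hence "hausdorff_outer_measure m ?Q \<le> ennreal (unit_ball_vol (real m) * (N * R) ^ m)"
    unfolding hausdorff_outer_measure_def by (intro SUP_least) auto
  thus ?thesis unfolding m_def by (simp add: order_le_less_trans)
qed

text \<open>
  The orthogonal projection onto the hyperplane of the disc does not increase distances, and it maps a sufficiently
  large coordinate face onto a set containing the disc.
\<close>

lemma hausdorff_disc_finite:
  fixes w :: "'a::euclidean_space"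
  assumes w: "norm w = 1" and r: "r > 0"
  shows "hausdorff_outer_measure (DIM('a) - 1) {x. x \<bullet> w = 0 \<and> norm x \<le> r} < \<infinity>"
proof -
  let ?D = "{x. x \<bullet> w = 0 \<and> norm x \<le> r}"
  have ww: "w \<bullet> w = 1" using w by (simp add: norm_eq_1)
  have "w \<noteq> 0" using w by auto
  then obtain k where k: "k \<in> Basis" "w \<bullet> k \<noteq> 0" using euclidean_all_zero_iff by blast
  \<comment> \<open>the point of the face that projects to \<open>y\<close> is \<open>y - (y \<bullet> k / (w \<bullet> k)) *\<^sub>R w\<close>\<close>
  define R where "R = r + r / \<bar>w \<bullet> k\<bar>"
  have R: "R > 0" using r k by (simp add: R_def add_pos_pos)
  let ?Q = "{x. x \<bullet> k = 0 \<and> (\<forall>b\<in>Basis. \<bar>x \<bullet> b\<bar> \<le> R)}"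
  define P where "P x = x - (x \<bullet> w) *\<^sub>R w" for x
  have "dist (P x) (P y) \<le> 1 * dist x y" for x y
  proof -
    have "P x - P y = (x - y) - ((x - y) \<bullet> w) *\<^sub>R w" by (simp add: P_def algebra_simps)
    moreover have "norm (z - (z \<bullet> w) *\<^sub>R w) \<le> norm z" for z
      unfolding norm_le by (simp add: algebra_simps inner_commute[of w z] ww power2_eq_square[symmetric])
    ultimately show ?thesis by (simp add: dist_norm)
  qed
  hence "hausdorff_outer_measure (DIM('a) - 1) (P ` ?Q) \<le> ennreal (1 ^ (DIM('a) - 1)) * hausdorff_outer_measure (DIM('a) - 1) ?Q"
    by (intro hausdorff_outer_measure_lipschitz_image) auto
  also have "\<dots> < \<infinity>" using hausdorff_coordinate_face_finite[OF k(1) R] by simp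
  finally have fin: "hausdorff_outer_measure (DIM('a) - 1) (P ` ?Q) < \<infinity>" .
  have "?D \<subseteq> P ` ?Q"
  proof
    fix y assume y: "y \<in> ?D"
    define z where "z = y - (y \<bullet> k / (w \<bullet> k)) *\<^sub>R w"
    have "\<bar>y \<bullet> k\<bar> \<le> norm y" using k Basis_le_norm by blast
    hence "\<bar>y \<bullet> k\<bar> / \<bar>w \<bullet> k\<bar> \<le> r / \<bar>w \<bullet> k\<bar>" using y by (intro divide_right_mono) auto
    hence "norm z \<le> R" unfolding z_def R_def using norm_triangle_ineq4[of y "(y \<bullet> k / (w \<bullet> k)) *\<^sub>R w"] y w by simp
    hence "\<bar>z \<bullet> b\<bar> \<le> R" if "b \<in> Basis" for b using Basis_le_norm[OF that, of z] by simp
    moreover have "z \<bullet> k = 0" using k by (simp add: z_def inner_diff_left)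
    moreover have "P z = y" using y by (simp add: P_def z_def inner_diff_left ww)
    ultimately show "y \<in> P ` ?Q" by (intro image_eqI[of _ _ z]) auto
  qed
  thus ?thesis using order.strict_trans1[OF hausdorff_outer_measure_mono fin] by blast
qed

section \<open>Inner normals\<close>

lemma inner_normal_cases: "inner_normal E x = 0 \<or> norm (inner_normal E x) = 1"
proof (cases "\<exists>!v. inner_unit_normal_at E x v")
  case True
  hence "inner_unit_normal_at E x (THE v. inner_unit_normal_at E x v)" by (rule theI')
  hence "norm (THE v. inner_unit_normal_at E x v) = 1" by (simp add: inner_unit_normal_at_def)
  thus ?thesis using True by (simp add: inner_normal_def)
qed (auto simp: inner_normal_def)

lemma inner_normal_eqI:
  assumes "inner_unit_normal_at E x v" "\<And>u. inner_unit_normal_at E x u \<Longrightarrow> u = v"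
  shows "inner_normal E x = v"
proof -
  have ex1: "\<exists>!v. inner_unit_normal_at E x v" using assms by blast
  moreover have "(THE v. inner_unit_normal_at E x v) = v" using assms by blast
  ultimately show ?thesis by (simp add: inner_normal_def)
qed

text \<open>
  The pairs of a point and two of its unit normals form a closed set, and the unit sphere is compact, so the
  projection to the points is closed.
\<close>

lemma closed_ex_inner_unit_normals:
  fixes E :: "'a::euclidean_space set"
  assumes Q: "closed Q"
  shows "closed {x. \<exists>v u. (v, u) \<in> Q \<and> inner_unit_normal_at E x v \<and> inner_unit_normal_at E x u}"
proof -
  define T where "T = (\<Inter>y\<in>E. {q :: ('a \<times> 'a) \<times> 'a. 0 \<le> (y - snd q) \<bullet> fst (fst q) \<and> 0 \<le> (y - snd q) \<bullet> snd (fst q)}) \<inter> (Q \<times> UNIV)"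
  have "closed T" unfolding T_def
    by (intro closed_Int closed_INT ballI closed_Collect_le closed_Collect_conj continuous_intros closed_Times Q closed_UNIV)
  hence "closed {x. \<exists>p. p \<in> sphere 0 1 \<times> sphere 0 1 \<and> (p, x) \<in> T}"
    by (intro closed_compact_projection compact_Times compact_sphere)
  also have "{x. \<exists>p. p \<in> sphere 0 1 \<times> sphere 0 1 \<and> (p, x) \<in> T} =
      {x. \<exists>v u. (v, u) \<in> Q \<and> inner_unit_normal_at E x v \<and> inner_unit_normal_at E x u}"
    by (fastforce simp: T_def inner_unit_normal_at_def)
  finally show ?thesis .
qed

text \<open>
  The set \<open>U\<close> of points with exactly one normal is Borel, since its complement among the points with a normal is a
  countable union of the closed sets where two normals differ by at least \<open>1 / (n + 1)\<close>. On \<open>U\<close> the preimage of a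
  closed set is given by the existence of a normal in it.
\<close>

lemma borel_measurable_inner_normal [measurable]:
  fixes E :: "'a::euclidean_space set"
  shows "inner_normal E \<in> borel_measurable borel"
proof -
  define U where "U = {x. \<exists>!v. inner_unit_normal_at E x v}"
  define W where "W Q = {x. \<exists>v u. (v, u) \<in> Q \<and> inner_unit_normal_at E x v \<and> inner_unit_normal_at E x u}" for Q
  have W: "closed Q \<Longrightarrow> W Q \<in> sets borel" for Q
    unfolding W_def by (intro borel_closed closed_ex_inner_unit_normals)
  have dist_closed: "closed {p :: 'a \<times> 'a. 1 / real (Suc n) \<le> dist (fst p) (snd p)}" for n
    by (intro closed_Collect_le continuous_intros)
  have "U = W UNIV - (\<Union>n. W {p. 1 / real (Suc n) \<le> dist (fst p) (snd p)})"
  proof (intro set_eqI iffI)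
    fix x assume "x \<in> W UNIV - (\<Union>n. W {p. 1 / real (Suc n) \<le> dist (fst p) (snd p)})"
    then obtain v where v: "inner_unit_normal_at E x v"
      and no: "\<And>n v u. inner_unit_normal_at E x v \<Longrightarrow> inner_unit_normal_at E x u \<Longrightarrow> \<not> 1 / real (Suc n) \<le> dist v u"
      unfolding W_def by auto
    have "u = v" if "inner_unit_normal_at E x u" for u
    proof (rule ccontr)
      assume "u \<noteq> v"
      then obtain n where "inverse (real (Suc n)) < dist u v"
        using reals_Archimedean[of "dist u v"] by auto
      thus False using no[OF that v, of n] by (simp add: inverse_eq_divide)
    qed
    thus "x \<in> U" using v by (auto simp: U_def)
  next
    fix x assume "x \<in> U"
    then obtain v where "inner_unit_normal_at E x v" "\<And>u. inner_unit_normal_at E x u \<Longrightarrow> u = v"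
      by (auto simp: U_def)
    hence "inner_unit_normal_at E x u \<longleftrightarrow> u = v" for u by blast
    thus "x \<in> W UNIV - (\<Union>n. W {p. 1 / real (Suc n) \<le> dist (fst p) (snd p)})"
      by (simp add: W_def) blast
  qed
  hence U: "U \<in> sets borel" using W[OF closed_UNIV] W[OF dist_closed] by auto
  show ?thesis
  proof (rule borel_measurableI)
    fix S :: "'a set" assume "open S"
    hence WS: "W (UNIV \<times> (- S)) \<in> sets borel" by (intro W closed_Times) auto
    have "inner_normal E -` S = (U - W (UNIV \<times> (- S))) \<union> (if 0 \<in> S then - U else {})"
    proof (intro set_eqI)
      fix x
      show "x \<in> inner_normal E -` S \<longleftrightarrow> x \<in> (U - W (UNIV \<times> (- S))) \<union> (if 0 \<in> S then - U else {})"
      proof (cases "x \<in> U")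
        case True
        then obtain v where v: "inner_unit_normal_at E x v" "\<And>u. inner_unit_normal_at E x u \<Longrightarrow> u = v"
          by (auto simp: U_def)
        have "inner_normal E x = v" using v by (rule inner_normal_eqI)
        moreover have "x \<in> W (UNIV \<times> (- S)) \<longleftrightarrow> v \<notin> S" using v unfolding W_def by blast
        ultimately show ?thesis using True by simp
      next
        case False
        hence "inner_normal E x = 0" by (simp add: U_def inner_normal_def)
        thus ?thesis using False by simp
      qed
    qed
    thus "inner_normal E -` S \<inter> space borel \<in> sets borel"
      using U WS by auto
  qed
qed

section \<open>A cone and a flat cone on its base\<close>

definition axial_dist :: "'a::euclidean_space \<Rightarrow> 'a \<Rightarrow> real" where
  "axial_dist w x = norm (x - (x \<bullet> w) *\<^sub>R w)"

text \<open>
  The cone below the disc of radius \<open>r\<close> has slope \<open>1\<close>, the cone above it has slope \<open>d\<close>. For \<open>d = 0\<close> the upper cone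
  degenerates and the disc itself becomes the upper face.
\<close>

definition double_cone :: "'a::euclidean_space \<Rightarrow> real \<Rightarrow> real \<Rightarrow> 'a set" where
  "double_cone w r d = {x. - (r - axial_dist w x) \<le> x \<bullet> w \<and> x \<bullet> w \<le> d * (r - axial_dist w x)}"

definition disc :: "'a::euclidean_space \<Rightarrow> real \<Rightarrow> 'a set" where
  "disc w r = {x. x \<bullet> w = 0 \<and> norm x < r}"

text \<open>
  The common lateral surface of all the double cones, rim included.
\<close>

definition mantle :: "'a::euclidean_space \<Rightarrow> real \<Rightarrow> 'a set" where
  "mantle w r = {x. x \<bullet> w = - (r - axial_dist w x) \<and> x \<bullet> w \<le> 0}"

text \<open>
  Maps the disc onto the mantle of the upper cone of slope \<open>d\<close>. For \<open>d = - 1\<close> it maps the closed disc onto the lower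
  mantle.
\<close>

definition lift :: "'a::euclidean_space \<Rightarrow> real \<Rightarrow> real \<Rightarrow> 'a \<Rightarrow> 'a" where
  "lift w r d x = x + (d * (r - norm x)) *\<^sub>R w"

lemma axial_dist_nonneg [simp]: "axial_dist w x \<ge> 0" by (simp add: axial_dist_def)

lemma continuous_on_axial_dist [continuous_intros]:
  "continuous_on S f \<Longrightarrow> continuous_on S (\<lambda>x. axial_dist w (f x))"
  unfolding axial_dist_def by (intro continuous_intros)

lemma axial_dist_orthogonal: "x \<bullet> w = 0 \<Longrightarrow> axial_dist w x = norm x"
  by (simp add: axial_dist_def)

lemma axial_dist_add_axis: "norm w = 1 \<Longrightarrow> axial_dist w (x + c *\<^sub>R w) = axial_dist w x"
  by (simp add: axial_dist_def algebra_simps norm_eq_1)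

lemma axial_dist_convex_comb:
  assumes "u \<ge> 0" "v \<ge> 0"
  shows "axial_dist w (u *\<^sub>R x + v *\<^sub>R y) \<le> u * axial_dist w x + v * axial_dist w y"
proof -
  have "(u *\<^sub>R x + v *\<^sub>R y) - ((u *\<^sub>R x + v *\<^sub>R y) \<bullet> w) *\<^sub>R w
     = u *\<^sub>R (x - (x \<bullet> w) *\<^sub>R w) + v *\<^sub>R (y - (y \<bullet> w) *\<^sub>R w)"
    by (simp add: algebra_simps)
  thus ?thesis unfolding axial_dist_def using assms
    by (metis abs_of_nonneg norm_scaleR norm_triangle_ineq)
qed

lemma norm_le_axial: "norm w = 1 \<Longrightarrow> norm x \<le> axial_dist w x + \<bar>x \<bullet> w\<bar>"
  unfolding axial_dist_def using norm_triangle_ineq[of "x - (x \<bullet> w) *\<^sub>R w" "(x \<bullet> w) *\<^sub>R w"] by simp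

lemma inner_le_axial_dist:
  assumes "e \<bullet> w = 0" shows "x \<bullet> e \<le> norm e * axial_dist w x"
proof -
  have "x \<bullet> e = (x - (x \<bullet> w) *\<^sub>R w) \<bullet> e" using assms by (simp add: inner_diff_left inner_commute[of w e])
  also have "\<dots> \<le> norm (x - (x \<bullet> w) *\<^sub>R w) * norm e" by (rule norm_cauchy_schwarz)
  finally show ?thesis by (simp add: axial_dist_def mult.commute)
qed

lemma double_cone_axial_le:
  assumes "x \<in> double_cone w r d" "d \<ge> 0"
  shows "axial_dist w x \<le> r"
proof -
  have "(1 + d) * (r - axial_dist w x) \<ge> 0" using assms by (simp add: double_cone_def algebra_simps)
  thus ?thesis using assms(2) by (simp add: zero_le_mult_iff)
qed

lemma double_cone_mono: "0 \<le> d \<Longrightarrow> double_cone w r 0 \<subseteq> double_cone w r d"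
  using double_cone_axial_le[of _ w r 0] by (fastforce simp: double_cone_def intro: order_trans)

lemma convex_double_cone:
  assumes d: "d \<ge> 0" shows "convex (double_cone w r d)"
proof (rule convexI)
  fix x y :: 'a and u v :: real
  assume x: "x \<in> double_cone w r d" and y: "y \<in> double_cone w r d" and uv: "0 \<le> u" "0 \<le> v" "u + v = 1"
  define p where "p = u *\<^sub>R x + v *\<^sub>R y"
  have rr: "r = u * r + v * r" using uv by (simp add: distrib_right[symmetric])
  have le: "axial_dist w p \<le> u * axial_dist w x + v * axial_dist w y"
    unfolding p_def using uv by (intro axial_dist_convex_comb)
  have pw: "p \<bullet> w = u * (x \<bullet> w) + v * (y \<bullet> w)" by (simp add: p_def inner_add_left)
  have "u * (axial_dist w x - r) + v * (axial_dist w y - r) \<le> p \<bullet> w"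
    unfolding pw using x y uv by (intro add_mono mult_left_mono) (auto simp: double_cone_def)
  hence lower: "- (r - axial_dist w p) \<le> p \<bullet> w" using le rr by (simp add: right_diff_distrib)
  have "p \<bullet> w \<le> u * (d * (r - axial_dist w x)) + v * (d * (r - axial_dist w y))"
    unfolding pw using x y uv by (intro add_mono mult_left_mono) (auto simp: double_cone_def)
  also have "\<dots> = d * (r - (u * axial_dist w x + v * axial_dist w y))"
    by (subst (3) rr) (simp add: algebra_simps)
  also have "\<dots> \<le> d * (r - axial_dist w p)" using le d by (intro mult_left_mono) auto
  finally have "p \<bullet> w \<le> d * (r - axial_dist w p)" .
  with lower show "u *\<^sub>R x + v *\<^sub>R y \<in> double_cone w r d" by (simp add: double_cone_def p_def)
qed

lemma open_double_cone_strict: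
  "open {x. - (r - axial_dist w x) < x \<bullet> w \<and> x \<bullet> w < d * (r - axial_dist w x)}"
  by (intro open_Collect_conj open_Collect_less continuous_intros)

lemma closed_double_cone: "closed (double_cone w r d)"
  unfolding double_cone_def by (intro closed_Collect_conj closed_Collect_le continuous_intros)

lemma double_cone_strict_interior:
  "{x. - (r - axial_dist w x) < x \<bullet> w \<and> x \<bullet> w < d * (r - axial_dist w x)} \<subseteq> interior (double_cone w r d)"
  using open_double_cone_strict by (intro interior_maximal) (auto simp: double_cone_def)

lemma convex_body_double_cone:
  assumes w: "norm w = 1" and r: "r > 0" and d: "d \<ge> 0"
  shows "convex_body (double_cone w r d)"
proof -
  have ww: "w \<bullet> w = 1" using w by (simp add: norm_eq_1)
  have "norm x \<le> r + (r + d * r)" if x: "x \<in> double_cone w r d" for x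
  proof -
    have "axial_dist w x \<le> r" using x d by (rule double_cone_axial_le)
    moreover have "d * (r - axial_dist w x) \<le> d * r" using d by (intro mult_left_mono) auto
    moreover have "0 \<le> d * r" using d r by simp
    ultimately have "\<bar>x \<bullet> w\<bar> \<le> r + d * r"
      using x r axial_dist_nonneg[of w x] unfolding double_cone_def abs_le_iff mem_Collect_eq by linarith
    thus ?thesis using norm_le_axial[OF w, of x] \<open>axial_dist w x \<le> r\<close> by linarith
  qed
  hence "bounded (double_cone w r d)" by (auto simp: bounded_iff)
  hence "compact (double_cone w r d)" using closed_double_cone by (simp add: compact_eq_bounded_closed)
  moreover have "(- (r / 2)) *\<^sub>R w \<in> interior (double_cone w r d)"
  proof (rule subsetD[OF double_cone_strict_interior])
    have "axial_dist w ((- (r / 2)) *\<^sub>R w) = 0" by (simp add: axial_dist_def ww)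
    moreover have "d * r \<ge> 0" using d r by simp
    ultimately show "(- (r / 2)) *\<^sub>R w \<in> {x. - (r - axial_dist w x) < x \<bullet> w \<and> x \<bullet> w < d * (r - axial_dist w x)}"
      using r ww by simp
  qed
  ultimately show ?thesis using convex_double_cone[OF d] unfolding convex_body_def by blast
qed

lemma frontier_double_cone_subset:
  assumes w: "norm w = 1" and d: "d \<ge> 0"
  shows "frontier (double_cone w r d) \<subseteq> lift w r d ` disc w r \<union> mantle w r"
proof
  have ww: "w \<bullet> w = 1" using w by (simp add: norm_eq_1)
  fix x assume "x \<in> frontier (double_cone w r d)"
  hence x: "x \<in> double_cone w r d" "x \<notin> interior (double_cone w r d)"
    using frontier_subset_closed[OF closed_double_cone] by (auto simp: frontier_def)
  have rho: "axial_dist w x \<le> r" using x(1) d by (rule double_cone_axial_le)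
  have "\<not> (- (r - axial_dist w x) < x \<bullet> w \<and> x \<bullet> w < d * (r - axial_dist w x))"
    using x(2) double_cone_strict_interior by blast
  then consider "x \<bullet> w = - (r - axial_dist w x)" | "x \<bullet> w = d * (r - axial_dist w x)"
    using x(1) by (fastforce simp: double_cone_def)
  thus "x \<in> lift w r d ` disc w r \<union> mantle w r"
  proof cases
    case 1
    thus ?thesis using rho by (simp add: mantle_def)
  next
    case 2
    show ?thesis
    proof (cases "axial_dist w x = r")
      case True
      thus ?thesis using 2 by (simp add: mantle_def)
    next
      case False
      define y where "y = x - (x \<bullet> w) *\<^sub>R w"
      have ny: "norm y = axial_dist w x" by (simp add: y_def axial_dist_def)
      hence "y \<in> disc w r" using False rho by (simp add: disc_def y_def inner_diff_left ww)
      moreover have "lift w r d y = x" unfolding lift_def ny using 2 by (simp add: y_def)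
      ultimately show ?thesis by blast
    qed
  qed
qed

lemma frontierI_axis:
  assumes "x \<in> S" "norm w = 1" "\<And>t. t > 0 \<Longrightarrow> x + t *\<^sub>R w \<notin> S"
  shows "x \<in> frontier S"
proof -
  have "x \<notin> interior S"
  proof
    assume "x \<in> interior S"
    then obtain e where e: "e > 0" "ball x e \<subseteq> S" by (auto simp: mem_interior)
    hence "x + (e / 2) *\<^sub>R w \<in> S" using assms(2) by (auto simp: dist_norm intro!: subsetD[OF e(2)])
    thus False using assms(3)[of "e/2"] e(1) by simp
  qed
  thus ?thesis using assms(1) closure_subset by (auto simp: frontier_def)
qed

lemma disc_subset_frontier:
  assumes w: "norm w = 1" shows "disc w r \<subseteq> frontier (double_cone w r 0)"
proof
  have ww: "w \<bullet> w = 1" using w by (simp add: norm_eq_1)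
  fix x assume "x \<in> disc w r"
  hence x: "x \<bullet> w = 0" "norm x < r" by (auto simp: disc_def)
  show "x \<in> frontier (double_cone w r 0)"
    using x ww by (intro frontierI_axis[OF _ w]) (auto simp: double_cone_def axial_dist_orthogonal inner_add_left)
qed

lemma mantle_subset_frontier:
  assumes w: "norm w = 1" and d: "d \<ge> 0" shows "mantle w r \<subseteq> frontier (double_cone w r d)"
proof
  have ww: "w \<bullet> w = 1" using w by (simp add: norm_eq_1)
  fix x assume "x \<in> mantle w r"
  hence x: "x \<bullet> w = - (r - axial_dist w x)" "x \<bullet> w \<le> 0" by (auto simp: mantle_def)
  have "d * (r - axial_dist w x) \<ge> 0" using x d by simp
  hence "x \<in> double_cone w r d" using x by (simp add: double_cone_def)
  moreover have "x + t *\<^sub>R (- w) \<notin> double_cone w r d" if "t > 0" for t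
    using x that axial_dist_add_axis[OF w, of x "-t"] ww by (simp add: double_cone_def inner_diff_left)
  ultimately show "x \<in> frontier (double_cone w r d)"
    using w by (intro frontierI_axis[of _ _ "- w"]) auto
qed

lemma disc_Int_mantle: "disc w r \<inter> mantle w r = {}"
  by (auto simp: disc_def mantle_def axial_dist_orthogonal)

text \<open>
  The cone contains a neighbourhood of \<open>x\<close> in the disc, which makes every normal parallel to the axis, and points
  below \<open>x\<close>, which fixes its sign.
\<close>

lemma inner_normal_disc:
  assumes w: "norm w = 1" and x: "x \<in> disc w r"
  shows "inner_normal (double_cone w r 0) x = - w"
proof (rule inner_normal_eqI)
  have ww: "w \<bullet> w = 1" using w by (simp add: norm_eq_1)
  have xw: "x \<bullet> w = 0" "norm x < r" using x by (auto simp: disc_def)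
  show "inner_unit_normal_at (double_cone w r 0) x (- w)"
    using w xw by (auto simp: inner_unit_normal_at_def double_cone_def inner_diff_left)
  fix v assume v: "inner_unit_normal_at (double_cone w r 0) x v"
  hence nv: "norm v = 1" and pos: "\<And>y. y \<in> double_cone w r 0 \<Longrightarrow> 0 \<le> (y - x) \<bullet> v"
    by (auto simp: inner_unit_normal_at_def)
  define \<eta> where "\<eta> = r - norm x"
  have \<eta>: "\<eta> > 0" using xw by (simp add: \<eta>_def)
  define u where "u = v - (v \<bullet> w) *\<^sub>R w"
  have uw: "u \<bullet> w = 0" by (simp add: u_def inner_diff_left ww)
  have nu: "norm u \<le> 2"
    using norm_triangle_ineq4[of v "(v \<bullet> w) *\<^sub>R w"] Cauchy_Schwarz_ineq2[of v w] nv w by (simp add: u_def)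
  have "x - (\<eta> / 2) *\<^sub>R u \<in> double_cone w r 0"
  proof -
    have "norm (x - (\<eta> / 2) *\<^sub>R u) \<le> norm x + (\<eta> / 2) * norm u"
      using norm_triangle_ineq4[of x "(\<eta> / 2) *\<^sub>R u"] \<eta> by simp
    also have "\<dots> \<le> norm x + \<eta> / 2 * 2" using nu \<eta> by (intro add_left_mono mult_left_mono) auto
    also have "\<dots> = r" by (simp add: \<eta>_def field_simps)
    finally have "norm (x - (\<eta> / 2) *\<^sub>R u) \<le> r" .
    moreover have "(x - (\<eta> / 2) *\<^sub>R u) \<bullet> w = 0" using xw uw by (simp add: inner_diff_left)
    ultimately show ?thesis by (simp add: double_cone_def axial_dist_orthogonal)
  qed
  from pos[OF this] have "u \<bullet> v \<le> 0" using \<eta> by (simp add: mult_le_0_iff)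
  moreover have "u \<bullet> v = u \<bullet> u" using uw by (simp add: u_def inner_diff_right)
  ultimately have "u = 0" by (metis inner_gt_zero_iff not_le)
  hence vw: "v = (v \<bullet> w) *\<^sub>R w" by (simp add: u_def)
  hence "\<bar>v \<bullet> w\<bar> = 1" using nv w by (metis mult.right_neutral norm_scaleR)
  moreover have "x - \<eta> *\<^sub>R w \<in> double_cone w r 0"
    using axial_dist_add_axis[OF w, of x "-\<eta>"] xw \<eta>
    by (simp add: double_cone_def inner_diff_left ww axial_dist_orthogonal) (simp add: \<eta>_def)
  from pos[OF this] have "w \<bullet> v \<le> 0" using \<eta> by (simp add: mult_le_0_iff)
  ultimately have "v \<bullet> w = -1" by (simp add: inner_commute)
  thus "v = - w" using vw by simp
qed

text \<open>
  Both mantles have a supporting hyperplane at the rim, so the normal is not unique and \<open>inner_normal\<close> takes its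
  default value \<open>0\<close>.
\<close>

lemma inner_normal_rim:
  assumes w: "norm w = 1" and r: "r > 0" and d: "d \<ge> 0" and x: "x \<bullet> w = 0" "norm x = r"
  shows "inner_normal (double_cone w r d) x = 0"
proof -
  have ww: "w \<bullet> w = 1" using w by (simp add: norm_eq_1)
  define e where "e = x /\<^sub>R r"
  have e: "norm e = 1" "e \<bullet> w = 0" "x = r *\<^sub>R e" using x r by (auto simp: e_def)
  have ee: "e \<bullet> e = 1" using e by (simp add: norm_eq_1)
  have normal: "inner_unit_normal_at (double_cone w r d) x (v /\<^sub>R norm v)"
    if "v \<noteq> 0" "\<And>y. y \<in> double_cone w r d \<Longrightarrow> 0 \<le> (y - x) \<bullet> v" for v
    using that by (auto simp: inner_unit_normal_at_def intro!: divide_nonneg_nonneg)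
  have ye: "y \<bullet> e \<le> axial_dist w y" for y using inner_le_axial_dist[OF e(2), of y] e by simp
  have e_w: "w \<bullet> e = 0" using e by (simp add: inner_commute)
  have "(y - x) \<bullet> (w - e) \<ge> 0" if "y \<in> double_cone w r d" for y
  proof -
    have "(y - x) \<bullet> (w - e) = y \<bullet> w - y \<bullet> e + r" by (simp add: e(3) inner_diff_left inner_diff_right e(2) ee)
    thus ?thesis using that ye[of y] by (simp add: double_cone_def)
  qed
  moreover have "(y - x) \<bullet> (- w - d *\<^sub>R e) \<ge> 0" if "y \<in> double_cone w r d" for y
  proof -
    have "(y - x) \<bullet> (- w - d *\<^sub>R e) = - (y \<bullet> w) + d * (r - y \<bullet> e)"
      by (simp add: e(3) inner_diff_left inner_diff_right e(2) ee algebra_simps)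
    moreover have "d * (r - axial_dist w y) \<le> d * (r - y \<bullet> e)" using ye[of y] d by (intro mult_left_mono) auto
    ultimately show ?thesis using that by (simp add: double_cone_def)
  qed
  moreover have s: "(w - e) \<bullet> w = 1" "(- w - d *\<^sub>R e) \<bullet> w = -1"
    by (simp_all add: inner_diff_left ww e(2))
  moreover have nz: "w - e \<noteq> 0" "- w - d *\<^sub>R e \<noteq> 0" using s by auto
  ultimately have 2: "inner_unit_normal_at (double_cone w r d) x ((w - e) /\<^sub>R norm (w - e))"
    "inner_unit_normal_at (double_cone w r d) x ((- w - d *\<^sub>R e) /\<^sub>R norm (- w - d *\<^sub>R e))"
    by (intro normal; blast)+
  have "((w - e) /\<^sub>R norm (w - e)) \<bullet> w > 0" "((- w - d *\<^sub>R e) /\<^sub>R norm (- w - d *\<^sub>R e)) \<bullet> w < 0"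
    using nz unfolding inner_scaleR_left s by simp_all
  hence "(w - e) /\<^sub>R norm (w - e) \<noteq> (- w - d *\<^sub>R e) /\<^sub>R norm (- w - d *\<^sub>R e)" by force
  hence "\<not> (\<exists>!v. inner_unit_normal_at (double_cone w r d) x v)" using 2 by blast
  thus ?thesis by (simp add: inner_normal_def)
qed

text \<open>
  Normals of a convex set are determined by its points near \<open>x\<close>, and below the disc the two bodies coincide.
\<close>

lemma inner_normal_mantle:
  assumes w: "norm w = 1" and d: "d \<ge> 0" and x: "x \<in> mantle w r" "x \<bullet> w < 0"
  shows "inner_normal (double_cone w r d) x = inner_normal (double_cone w r 0) x"
proof -
  have "inner_unit_normal_at (double_cone w r d) x v \<longleftrightarrow> inner_unit_normal_at (double_cone w r 0) x v" for v
  proof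
    assume "inner_unit_normal_at (double_cone w r d) x v"
    thus "inner_unit_normal_at (double_cone w r 0) x v"
      using double_cone_mono[OF d] by (auto simp: inner_unit_normal_at_def)
  next
    assume v: "inner_unit_normal_at (double_cone w r 0) x v"
    have "0 \<le> (y - x) \<bullet> v" if y: "y \<in> double_cone w r d" for y
    proof -
      \<comment> \<open>small enough for \<open>x + t *\<^sub>R (y - x)\<close> to stay below the disc\<close>
      define t where "t = min 1 (- (x \<bullet> w) / (1 + \<bar>(y - x) \<bullet> w\<bar>))"
      have "0 < - (x \<bullet> w) / (1 + \<bar>(y - x) \<bullet> w\<bar>)" using x(2) by (intro divide_pos_pos) auto
      hence t: "0 < t" "t \<le> 1" by (auto simp: t_def)
      have "t * ((y - x) \<bullet> w) \<le> t * (1 + \<bar>(y - x) \<bullet> w\<bar>)" using t by (intro mult_left_mono) auto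
      also have "\<dots> \<le> - (x \<bullet> w) / (1 + \<bar>(y - x) \<bullet> w\<bar>) * (1 + \<bar>(y - x) \<bullet> w\<bar>)"
        by (intro mult_right_mono) (auto simp: t_def)
      also have "\<dots> = - (x \<bullet> w)" by (simp add: field_simps)
      finally have le0: "(x + t *\<^sub>R (y - x)) \<bullet> w \<le> 0" by (simp add: inner_add_left)
      have "x \<in> double_cone w r d"
        using mantle_subset_frontier[OF w d] x(1) closed_double_cone frontier_subset_closed by blast
      hence "(1 - t) *\<^sub>R x + t *\<^sub>R y \<in> double_cone w r d"
        using t y by (intro convexD[OF convex_double_cone[OF d]]) auto
      moreover have "(1 - t) *\<^sub>R x + t *\<^sub>R y = x + t *\<^sub>R (y - x)" by (simp add: algebra_simps)
      ultimately have "x + t *\<^sub>R (y - x) \<in> double_cone w r 0" using le0 by (simp add: double_cone_def)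
      hence "0 \<le> (x + t *\<^sub>R (y - x) - x) \<bullet> v" using v unfolding inner_unit_normal_at_def by blast
      thus ?thesis using t by (simp add: zero_le_mult_iff)
    qed
    thus "inner_unit_normal_at (double_cone w r d) x v" using v by (simp add: inner_unit_normal_at_def)
  qed
  hence "inner_unit_normal_at (double_cone w r d) x = inner_unit_normal_at (double_cone w r 0) x" by (rule ext)
  thus ?thesis by (simp add: inner_normal_def)
qed

text \<open>
  The Lipschitz constant differs from \<open>1\<close> only to second order in \<open>d\<close>, because the displacement is orthogonal to the
  disc. The sharp constant is \<open>sqrt (1 + d\<^sup>2)\<close>.
\<close>

lemma lift_lipschitz:
  assumes w: "norm w = 1" and x: "x \<bullet> w = 0" and y: "y \<bullet> w = 0"
  shows "dist (lift w r d x) (lift w r d y) \<le> (1 + d\<^sup>2) * dist x y"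
proof -
  have ww: "w \<bullet> w = 1" using w by (simp add: norm_eq_1)
  define c where "c = d * (norm y - norm x)"
  have eq: "lift w r d x - lift w r d y = (x - y) + c *\<^sub>R w" by (simp add: lift_def c_def algebra_simps)
  have "(norm ((x - y) + c *\<^sub>R w))\<^sup>2 = (norm (x - y))\<^sup>2 + c\<^sup>2"
    using norm_add_Pythagorean[of "x - y" "c *\<^sub>R w"] x y w
    by (simp add: orthogonal_def inner_diff_left)
  also have "c\<^sup>2 \<le> (d * norm (x - y))\<^sup>2"
  proof -
    have "\<bar>norm y - norm x\<bar> \<le> norm (x - y)" by norm
    hence "\<bar>c\<bar> \<le> \<bar>d * norm (x - y)\<bar>" unfolding c_def abs_mult by (intro mult_left_mono) auto
    thus ?thesis by (simp add: abs_le_square_iff)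
  qed
  also have "(norm (x - y))\<^sup>2 + (d * norm (x - y))\<^sup>2 = (1 + d\<^sup>2) * (norm (x - y))\<^sup>2"
    by (simp add: algebra_simps power_mult_distrib)
  also have "\<dots> \<le> (1 + d\<^sup>2)\<^sup>2 * (norm (x - y))\<^sup>2"
    using power_increasing[of 1 2 "1 + d\<^sup>2"] by (intro mult_right_mono) auto
  finally have "(norm (lift w r d x - lift w r d y))\<^sup>2 \<le> ((1 + d\<^sup>2) * norm (x - y))\<^sup>2"
    unfolding eq by (simp add: power_mult_distrib)
  hence "norm (lift w r d x - lift w r d y) \<le> (1 + d\<^sup>2) * norm (x - y)"
    by (rule power2_le_imp_le) auto
  thus ?thesis by (simp add: dist_norm)
qed

lemma mantle_subset_lift: "norm w = 1 \<Longrightarrow> mantle w r \<subseteq> lift w r (-1) ` {x. x \<bullet> w = 0 \<and> norm x \<le> r}"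
proof
  assume w: "norm w = 1"
  have ww: "w \<bullet> w = 1" using w by (simp add: norm_eq_1)
  fix x assume x: "x \<in> mantle w r"
  define y where "y = x - (x \<bullet> w) *\<^sub>R w"
  have ny: "norm y = axial_dist w x" by (simp add: y_def axial_dist_def)
  have "-1 * (r - axial_dist w x) = x \<bullet> w" using x by (simp add: mantle_def)
  hence "lift w r (-1) y = x" unfolding lift_def ny by (simp add: y_def)
  moreover have "y \<bullet> w = 0" by (simp add: y_def inner_diff_left ww)
  moreover have "norm y \<le> r" using x by (simp add: ny mantle_def)
  ultimately show "x \<in> lift w r (-1) ` {x. x \<bullet> w = 0 \<and> norm x \<le> r}" by (intro image_eqI[of _ _ y]) auto
qed

lemma hausdorff_mantle_finite:
  fixes w :: "'a::euclidean_space"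
  assumes w: "norm w = 1" and r: "r > 0"
  shows "hausdorff_outer_measure (DIM('a) - 1) (mantle w r) < \<infinity>"
proof -
  let ?H = "hausdorff_outer_measure (DIM('a) - 1)" and ?D = "{x. x \<bullet> w = 0 \<and> norm x \<le> r}"
  have "?H (mantle w r) \<le> ?H (lift w r (-1) ` ?D)"
    by (intro hausdorff_outer_measure_mono mantle_subset_lift w)
  also have "\<dots> \<le> ennreal ((1 + (-1)\<^sup>2) ^ (DIM('a) - 1)) * ?H ?D"
    by (intro hausdorff_outer_measure_lipschitz_image lift_lipschitz[OF w]) auto
  also have "\<dots> < \<infinity>" using hausdorff_disc_finite[OF w r] by (simp add: ennreal_mult_less_top)
  finally show ?thesis .
qed

lemma borel_disc [measurable]: "disc w r \<in> sets borel"
proof -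
  have "closed {x. x \<bullet> w = 0}" "open {x::'a. norm x < r}"
    by (intro closed_Collect_eq open_Collect_less continuous_intros)+
  hence "{x. x \<bullet> w = 0} \<inter> {x. norm x < r} \<in> sets borel" by (intro sets.Int borel_closed borel_open)
  thus ?thesis by (simp add: disc_def Collect_conj_eq)
qed

lemma closed_mantle: "closed (mantle w r)"
  unfolding mantle_def
  by (intro closed_Collect_conj closed_Collect_eq closed_Collect_le continuous_intros)

lemma lift_disc_eq:
  assumes w: "norm w = 1"
  shows "lift w r d ` disc w r = {x. x \<bullet> w = d * (r - axial_dist w x)} \<inter> {x. axial_dist w x < r}"
proof -
  have ww: "w \<bullet> w = 1" using w by (simp add: norm_eq_1)
  show ?thesis
  proof (intro equalityI subsetI)
    fix x assume "x \<in> lift w r d ` disc w r"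
    then obtain y where y: "x = y + (d * (r - norm y)) *\<^sub>R w" "y \<bullet> w = 0" "norm y < r"
      by (auto simp: lift_def disc_def)
    have "axial_dist w x = norm y" unfolding y(1) axial_dist_add_axis[OF w] by (simp add: axial_dist_orthogonal y(2))
    moreover have "x \<bullet> w = d * (r - norm y)" by (simp add: y(1) inner_add_left y(2) ww)
    ultimately show "x \<in> {x. x \<bullet> w = d * (r - axial_dist w x)} \<inter> {x. axial_dist w x < r}" using y(3) by simp
  next
    fix x assume x: "x \<in> {x. x \<bullet> w = d * (r - axial_dist w x)} \<inter> {x. axial_dist w x < r}"
    define y where "y = x - (x \<bullet> w) *\<^sub>R w"
    have ny: "norm y = axial_dist w x" by (simp add: y_def axial_dist_def)
    have "y \<in> disc w r" using x by (simp add: disc_def ny) (simp add: y_def inner_diff_left ww)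
    moreover have "lift w r d y = x" unfolding lift_def ny using x by (simp add: y_def)
    ultimately show "x \<in> lift w r d ` disc w r" by blast
  qed
qed

lemma borel_lift_disc: "norm w = 1 \<Longrightarrow> lift w r d ` disc w r \<in> sets borel"
  unfolding lift_disc_eq
  by (intro sets.Int borel_closed borel_open closed_Collect_eq open_Collect_less continuous_intros)

section \<open>The weighted perimeter under translations and averaging\<close>

abbreviation surface_measure :: "'a::euclidean_space measure" where
  "surface_measure \<equiv> hausdorff_measure (DIM('a) - 1)"

text \<open>
  The one-sided substitute for the area formula: the inequality for sets passes to integrals.
\<close>

lemma nn_integral_lipschitz_image:
  fixes \<psi> :: "'a::metric_space \<Rightarrow> 'a"
  assumes lip: "\<And>x y. x \<in> S \<Longrightarrow> y \<in> S \<Longrightarrow> dist (\<psi> x) (\<psi> y) \<le> L * dist x y" and L: "L > 0"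
    and S [measurable]: "S \<in> sets borel" and \<psi>S [measurable]: "\<psi> ` S \<in> sets borel"
    and \<psi> [measurable]: "\<psi> \<in> borel_measurable borel" and G [measurable]: "G \<in> borel_measurable borel"
  shows "(\<integral>\<^sup>+x\<in>\<psi> ` S. G x \<partial>hausdorff_measure m) \<le> ennreal (L ^ m) * (\<integral>\<^sup>+x\<in>S. G (\<psi> x) \<partial>hausdorff_measure m)"
proof -
  let ?H = "hausdorff_measure m :: 'a measure"
  let ?M = "density ?H (indicator (\<psi> ` S))"
  let ?N = "scale_measure (ennreal (L ^ m)) (distr (density ?H (indicator S)) borel \<psi>)"
  have "?M \<le> ?N"
  proof (subst le_measure, safe)
    fix A assume "A \<in> sets ?M"
    hence A [measurable]: "A \<in> sets borel" by simp
    have pre [measurable]: "\<psi> -` A \<in> sets borel" using measurable_sets[OF \<psi> A] by simp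
    have "emeasure ?M A = hausdorff_outer_measure m (\<psi> ` S \<inter> A)"
      by (simp add: emeasure_restricted emeasure_hausdorff_measure)
    also have "\<psi> ` S \<inter> A = \<psi> ` (S \<inter> \<psi> -` A)" by auto
    also have "hausdorff_outer_measure m \<dots> \<le> ennreal (L ^ m) * hausdorff_outer_measure m (S \<inter> \<psi> -` A)"
      using L by (intro hausdorff_outer_measure_lipschitz_image lip) auto
    also have "\<dots> = emeasure ?N A"
      by (simp add: emeasure_distr emeasure_restricted emeasure_hausdorff_measure)
    finally show "emeasure ?M A \<le> emeasure ?N A" .
  qed simp_all
  hence "nn_integral ?M G \<le> nn_integral ?N G" by (intro nn_integral_mono_measure) simp
  thus ?thesis
    by (simp add: nn_integral_density nn_integral_scale_measure nn_integral_distr mult.commute)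
qed

lemma nn_integral_hausdorff_translate:
  fixes h :: "'a::euclidean_space \<Rightarrow> ennreal"
  assumes h [measurable]: "h \<in> borel_measurable borel"
  shows "(\<integral>\<^sup>+x. h (x + y) \<partial>hausdorff_measure m) = (\<integral>\<^sup>+x. h x \<partial>hausdorff_measure m)"
proof (rule antisym)
  have le: "(\<integral>\<^sup>+x. h x \<partial>hausdorff_measure m) \<le> (\<integral>\<^sup>+x. h (x + y) \<partial>hausdorff_measure m)"
    if [measurable]: "h \<in> borel_measurable borel" for h :: "'a \<Rightarrow> ennreal" and y
    using nn_integral_lipschitz_image[of UNIV "\<lambda>x. x + y" 1 h m] by (simp add: surj_plus_right)
  show "(\<integral>\<^sup>+x. h x \<partial>hausdorff_measure m) \<le> (\<integral>\<^sup>+x. h (x + y) \<partial>hausdorff_measure m)" by (rule le) fact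
  show "(\<integral>\<^sup>+x. h (x + y) \<partial>hausdorff_measure m) \<le> (\<integral>\<^sup>+x. h x \<partial>hausdorff_measure m)"
    using le[of "\<lambda>x. h (x + y)" "- y"] by simp
qed

definition weighted_perimeter :: "('a \<Rightarrow> ennreal) \<Rightarrow> ('a \<Rightarrow> ennreal) \<Rightarrow> 'a::euclidean_space set \<Rightarrow> ennreal" where
  "weighted_perimeter g \<Phi> E = (\<integral>\<^sup>+ x \<in> frontier E. g x * \<Phi> (inner_normal E x) \<partial>surface_measure)"

lemma inner_normal_translate: "inner_normal ((+) y ` E) (x + y) = inner_normal E x"
proof -
  have "inner_unit_normal_at ((+) y ` E) (x + y) = inner_unit_normal_at E x"
    by (rule ext) (simp add: inner_unit_normal_at_def algebra_simps)
  thus ?thesis by (simp add: inner_normal_def)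
qed

lemma weighted_perimeter_translate:
  fixes E :: "'a::euclidean_space set"
  assumes [measurable]: "g \<in> borel_measurable borel" "\<Phi> \<in> borel_measurable borel"
  shows "weighted_perimeter g \<Phi> ((+) y ` E) = weighted_perimeter (\<lambda>x. g (x + y)) \<Phi> E"
proof -
  have [measurable]: "frontier F \<in> sets borel" for F :: "'a set" by (simp add: borel_closed)
  have "x + y \<in> frontier ((+) y ` E) \<longleftrightarrow> x \<in> frontier E" for x
    unfolding frontier_translation by (auto simp: image_iff add.commute)
  hence *: "indicator (frontier ((+) y ` E)) (x + y) = (indicator (frontier E) x :: ennreal)" for x
    by (simp add: indicator_def)
  show ?thesis unfolding weighted_perimeter_def
    by (subst nn_integral_hausdorff_translate[symmetric, where y = y]) (simp_all add: * inner_normal_translate)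
qed

lemma convex_body_translate: "convex_body E \<Longrightarrow> convex_body ((+) y ` E)"
  unfolding convex_body_def
  by (simp add: compact_translation convex_translation interior_translation)

text \<open>
  Tonelli's theorem, applied on the frontier, where the surface measure is finite. Since \<open>g (x + \<tau> z)\<close> as a weight
  on \<open>E\<close> amounts to the weight \<open>g\<close> on the translate of \<open>E\<close> by \<open>\<tau> z\<close>, monotonicity of the perimeter passes from \<open>g\<close> to
  every such average.
\<close>

lemma weighted_perimeter_average:
  fixes E :: "'a::euclidean_space set"
  assumes [measurable]: "g \<in> borel_measurable borel" "\<Phi> \<in> borel_measurable borel"
    and N: "sigma_finite_measure N" and [measurable]: "k \<in> borel_measurable N" "\<tau> \<in> measurable N borel"
    and fin: "hausdorff_outer_measure (DIM('a) - 1) (frontier E) < \<infinity>"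
  shows "weighted_perimeter (\<lambda>x. \<integral>\<^sup>+z. k z * g (x + \<tau> z) \<partial>N) \<Phi> E =
    (\<integral>\<^sup>+z. k z * weighted_perimeter (\<lambda>x. g (x + \<tau> z)) \<Phi> E \<partial>N)"
proof -
  let ?H = "surface_measure :: 'a measure" and ?\<Phi> = "\<lambda>x. \<Phi> (inner_normal E x)"
  let ?R = "density ?H (indicator (frontier E))"
  have [measurable]: "frontier E \<in> sets borel" by (simp add: borel_closed)
  interpret N: sigma_finite_measure N by fact
  interpret R: finite_measure ?R
    using fin by (intro finite_measureI) (simp add: emeasure_restricted emeasure_hausdorff_measure)
  interpret P: pair_sigma_finite N ?R ..
  have [measurable_cong]: "sets ?R = sets borel" by simp
  have eq: "weighted_perimeter h \<Phi> E = (\<integral>\<^sup>+x. h x * ?\<Phi> x \<partial>?R)" if [measurable]: "h \<in> borel_measurable borel" for h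
    unfolding weighted_perimeter_def by (subst nn_integral_density) (auto simp: mult_ac)
  have "weighted_perimeter (\<lambda>x. \<integral>\<^sup>+z. k z * g (x + \<tau> z) \<partial>N) \<Phi> E
      = (\<integral>\<^sup>+x. (\<integral>\<^sup>+z. k z * g (x + \<tau> z) \<partial>N) * ?\<Phi> x \<partial>?R)"
    by (intro eq) measurable
  also have "\<dots> = (\<integral>\<^sup>+x. (\<integral>\<^sup>+z. k z * g (x + \<tau> z) * ?\<Phi> x \<partial>N) \<partial>?R)"
    by (simp add: nn_integral_multc)
  also have "\<dots> = (\<integral>\<^sup>+z. (\<integral>\<^sup>+x. k z * g (x + \<tau> z) * ?\<Phi> x \<partial>?R) \<partial>N)"
    by (rule P.Fubini') measurable
  also have "\<dots> = (\<integral>\<^sup>+z. k z * weighted_perimeter (\<lambda>x. g (x + \<tau> z)) \<Phi> E \<partial>N)"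
    by (intro nn_integral_cong) (simp add: eq mult.assoc nn_integral_cmult)
  finally show ?thesis .
qed

lemma hausdorff_frontier_double_cone_finite:
  fixes w :: "'a::euclidean_space"
  assumes w: "norm w = 1" and r: "r > 0" and d: "d \<ge> 0"
  shows "hausdorff_outer_measure (DIM('a) - 1) (frontier (double_cone w r d)) < \<infinity>"
proof -
  let ?H = "hausdorff_outer_measure (DIM('a) - 1)"
  have "disc w r \<subseteq> {x. x \<bullet> w = 0 \<and> norm x \<le> r}" by (auto simp: disc_def)
  hence "?H (disc w r) < \<infinity>"
    using order.strict_trans1[OF hausdorff_outer_measure_mono hausdorff_disc_finite[OF w r]] by blast
  moreover have "?H (lift w r d ` disc w r) \<le> ennreal ((1 + d\<^sup>2) ^ (DIM('a) - 1)) * ?H (disc w r)"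
    by (intro hausdorff_outer_measure_lipschitz_image lift_lipschitz[OF w]) (auto simp: disc_def add_pos_nonneg)
  ultimately have "?H (lift w r d ` disc w r) < \<infinity>"
    by (metis ennreal_less_top ennreal_mult_less_top infinity_ennreal_def order_le_less_trans)
  moreover have "?H (frontier (double_cone w r d)) \<le> ?H (lift w r d ` disc w r) + ?H (mantle w r)"
    using order_trans[OF hausdorff_outer_measure_mono[OF frontier_double_cone_subset[OF w d]] hausdorff_outer_measure_Un] .
  ultimately show ?thesis using hausdorff_mantle_finite[OF w r]
    by (simp add: order_le_less_trans)
qed

section \<open>The first variation under raising a disc\<close>

text \<open>
  The mantle contributes at least as much to the perimeter of the lower cone as to that of the double cone, and a
  finite amount, so it cancels. What remains is the disc, with the value \<open>M\<close> of \<open>\<Phi>\<close>, against the raised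
  disc, where \<open>\<Phi>\<close> is at most \<open>M\<close>.
\<close>

lemma disc_integral_le_lift:
  fixes w :: "'a::euclidean_space"
  assumes w: "norm w = 1" and r: "r > 0" and d: "d \<ge> 0"
    and [measurable]: "G \<in> borel_measurable borel" "\<Phi> \<in> borel_measurable borel"
    and \<Phi>0: "\<Phi> 0 = 0" and \<Phi>M: "\<And>v. norm v = 1 \<Longrightarrow> \<Phi> v \<le> ennreal M" and \<Phi>w: "\<Phi> (- w) = ennreal M" and M: "M > 0"
    and K: "\<And>x. norm x \<le> 2 * r \<Longrightarrow> G x \<le> ennreal K"
    and le: "weighted_perimeter G \<Phi> (double_cone w r 0) \<le> weighted_perimeter G \<Phi> (double_cone w r d)"
  shows "(\<integral>\<^sup>+x\<in>disc w r. G x \<partial>surface_measure) \<le>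
     ennreal ((1 + d\<^sup>2) ^ (DIM('a) - 1)) * (\<integral>\<^sup>+x\<in>disc w r. G (lift w r d x) \<partial>surface_measure)"
proof -
  let ?H = "surface_measure :: 'a measure"
  let ?L = "ennreal ((1 + d\<^sup>2) ^ (DIM('a) - 1))"
  let ?D = "disc w r" and ?T = "lift w r d ` disc w r" and ?S = "mantle w r"
  define \<nu> where "\<nu> d x = \<Phi> (inner_normal (double_cone w r d) x)" for d x
  have [measurable]: "?T \<in> sets borel" by (rule borel_lift_disc[OF w])
  have [measurable]: "?S \<in> sets borel" using closed_mantle by (rule borel_closed)
  have [measurable]: "\<nu> d \<in> borel_measurable borel" for d unfolding \<nu>_def by measurable
  have [measurable]: "frontier F \<in> sets borel" for F :: "'a set" by (simp add: borel_closed)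
  have \<nu>M: "\<nu> d x \<le> ennreal M" for d x
    using inner_normal_cases[of "double_cone w r d" x] \<Phi>0 \<Phi>M by (auto simp: \<nu>_def)
  have \<nu>D: "\<nu> 0 x = ennreal M" if "x \<in> ?D" for x using inner_normal_disc[OF w that] \<Phi>w by (simp add: \<nu>_def)
  \<comment> \<open>an equality below the rim; on the rim the left-hand side is \<open>\<Phi> 0 = 0\<close>\<close>
  have \<nu>S: "\<nu> d x \<le> \<nu> 0 x" if "x \<in> ?S" for x
  proof (cases "x \<bullet> w < 0")
    case True
    thus ?thesis using inner_normal_mantle[OF w d that] by (simp add: \<nu>_def)
  next
    case False
    hence "x \<bullet> w = 0" "norm x = r" using that by (auto simp: mantle_def axial_dist_orthogonal[symmetric])
    thus ?thesis using inner_normal_rim[OF w r d] \<Phi>0 by (simp add: \<nu>_def)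
  qed
  define X where "X = (\<integral>\<^sup>+x\<in>?S. G x * \<nu> 0 x \<partial>?H)"
  have "X \<le> (\<integral>\<^sup>+x. ennreal K * ennreal M * indicator ?S x \<partial>?H)"
    unfolding X_def
  proof (intro nn_integral_mono)
    fix x
    have "norm x \<le> 2 * r" if "x \<in> ?S"
    proof -
      have "axial_dist w x \<le> r" "\<bar>x \<bullet> w\<bar> = r - axial_dist w x" using that by (auto simp: mantle_def)
      thus ?thesis using norm_le_axial[OF w, of x] axial_dist_nonneg[of w x] r by linarith
    qed
    thus "G x * \<nu> 0 x * indicator ?S x \<le> ennreal K * ennreal M * indicator ?S x"
      using K[of x] \<nu>M[of 0 x] by (auto simp: indicator_def intro!: mult_mono)
  qed
  also have "\<dots> = ennreal K * ennreal M * hausdorff_outer_measure (DIM('a) - 1) ?S"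
    by (simp add: nn_integral_cmult_indicator emeasure_hausdorff_measure)
  also have "\<dots> < \<infinity>" using hausdorff_mantle_finite[OF w r] by (simp add: ennreal_mult_less_top)
  finally have X: "X < \<infinity>" .
  have "ennreal M * (\<integral>\<^sup>+x\<in>?D. G x \<partial>?H) + X = (\<integral>\<^sup>+x. ennreal M * (G x * indicator ?D x) + G x * \<nu> 0 x * indicator ?S x \<partial>?H)"
    unfolding X_def by (subst nn_integral_add) (simp_all add: nn_integral_cmult)
  also have "\<dots> \<le> (\<integral>\<^sup>+x\<in>frontier (double_cone w r 0). G x * \<nu> 0 x \<partial>?H)"
  proof (intro nn_integral_mono)
    fix x
    show "ennreal M * (G x * indicator ?D x) + G x * \<nu> 0 x * indicator ?S x
        \<le> G x * \<nu> 0 x * indicator (frontier (double_cone w r 0)) x"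
      using disc_subset_frontier[OF w, of r] mantle_subset_frontier[OF w, of 0 r] disc_Int_mantle[of w r] \<nu>D[of x]
      by (cases "x \<in> ?D"; cases "x \<in> ?S") (auto simp: mult.commute)
  qed
  also have "\<dots> \<le> (\<integral>\<^sup>+x\<in>frontier (double_cone w r d). G x * \<nu> d x \<partial>?H)"
    using le unfolding weighted_perimeter_def \<nu>_def .
  also have "\<dots> \<le> (\<integral>\<^sup>+x. ennreal M * (G x * indicator ?T x) + G x * \<nu> 0 x * indicator ?S x \<partial>?H)"
  proof (intro nn_integral_mono)
    fix x
    consider "x \<notin> frontier (double_cone w r d)" | "x \<in> ?S" | "x \<in> ?T"
      using frontier_double_cone_subset[OF w d, of r] by blast
    thus "G x * \<nu> d x * indicator (frontier (double_cone w r d)) x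
        \<le> ennreal M * (G x * indicator ?T x) + G x * \<nu> 0 x * indicator ?S x"
    proof cases
      case 2
      have "G x * \<nu> d x * indicator (frontier (double_cone w r d)) x \<le> G x * \<nu> d x"
        by (auto simp: indicator_def)
      also have "\<dots> \<le> G x * \<nu> 0 x" using \<nu>S[OF 2] by (intro mult_left_mono) auto
      also have "\<dots> \<le> ennreal M * (G x * indicator ?T x) + G x * \<nu> 0 x * indicator ?S x"
        using 2 by simp
      finally show ?thesis .
    next
      case 3
      have "G x * \<nu> d x * indicator (frontier (double_cone w r d)) x \<le> G x * \<nu> d x"
        by (auto simp: indicator_def)
      also have "\<dots> \<le> G x * ennreal M" using \<nu>M by (intro mult_left_mono) auto
      also have "\<dots> \<le> ennreal M * (G x * indicator ?T x) + G x * \<nu> 0 x * indicator ?S x"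
        using 3 by (simp add: mult.commute)
      finally show ?thesis .
    qed simp
  qed
  also have "\<dots> = ennreal M * (\<integral>\<^sup>+x\<in>?T. G x \<partial>?H) + X"
    unfolding X_def by (subst nn_integral_add) (simp_all add: nn_integral_cmult)
  finally have "ennreal M * (\<integral>\<^sup>+x\<in>?D. G x \<partial>?H) \<le> ennreal M * (\<integral>\<^sup>+x\<in>?T. G x \<partial>?H)"
    using X by (auto simp: ennreal_add_left_cancel_le add.commute[of _ X])
  hence "(\<integral>\<^sup>+x\<in>?D. G x \<partial>?H) \<le> (\<integral>\<^sup>+x\<in>?T. G x \<partial>?H)"
    using M by (subst (asm) ennreal_mult_le_mult_iff) auto
  also have "\<dots> \<le> ?L * (\<integral>\<^sup>+x\<in>?D. G (lift w r d x) \<partial>?H)"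
  proof (rule nn_integral_lipschitz_image)
    show "lift w r d \<in> borel_measurable borel"
      unfolding lift_def by (intro borel_measurable_continuous_onI continuous_intros)
    show "?T \<in> sets borel" by (rule borel_lift_disc[OF w])
  qed (auto intro!: lift_lipschitz[OF w] simp: disc_def[of w r] add_pos_nonneg)
  finally show ?thesis .
qed

text \<open>
  The chord of the convex function \<open>t \<mapsto> (1 + t) ^ m\<close> over the unit interval.
\<close>

lemma power_one_plus_le:
  fixes t :: real assumes "0 \<le> t" "t \<le> 1"
  shows "(1 + t) ^ m \<le> 1 + (2 ^ m - 1) * t"
proof (induction m)
  case (Suc m)
  define c where "c = (2::real) ^ m - 1"
  have c: "c \<ge> 0" by (simp add: c_def)
  have "(1 + t) ^ Suc m \<le> (1 + t) * (1 + c * t)"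
    using Suc assms by (auto intro: mult_left_mono simp: c_def)
  also have "\<dots> = 1 + (1 + c) * t + c * (t * t)" by (simp add: algebra_simps)
  also have "\<dots> \<le> 1 + (1 + c) * t + c * t"
    using assms c mult_left_le[of t t] by (intro add_left_mono mult_left_mono) auto
  also have "\<dots> = 1 + (2 ^ Suc m - 1) * t" by (simp add: c_def algebra_simps)
  finally show ?case .
qed simp

text \<open>
  A loss of first order in \<open>d\<close> cannot be compensated by a factor \<open>1 + O(d\<^sup>2)\<close>.
\<close>

lemma no_first_order_gain:
  fixes I J :: real
  assumes I: "I \<ge> 0" and J: "J > 0"
    and le: "\<And>d. 0 < d \<Longrightarrow> d < 1 \<Longrightarrow> I \<le> (1 + d\<^sup>2) ^ m * (I - d * J)"
  shows False
proof -
  define C where "C = (2::real) ^ m"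
  have C: "C > 0" by (simp add: C_def)
  \<comment> \<open>makes \<open>C * d * I\<close> smaller than \<open>J\<close>\<close>
  define d where "d = min (1/2) (J / (2 * C * (I + 1)))"
  have den: "2 * C * (I + 1) > 0" using C I by simp
  have d: "0 < d" "d < 1" using J den by (auto simp: d_def)
  have d2: "0 \<le> d\<^sup>2" "d\<^sup>2 \<le> 1" using d by (auto simp: power_le_one)
  have pos: "(1 + d\<^sup>2) ^ m > 0" by (simp add: add_pos_nonneg)
  hence ge0: "I - d * J \<ge> 0" using le[OF d] I by (metis mult_less_0_iff not_le order_le_less_trans)
  have "(1 + d\<^sup>2) ^ m \<le> 1 + C * d\<^sup>2" using power_one_plus_le[OF d2, of m] d2(1) unfolding C_def left_diff_distrib by linarith
  hence "I \<le> (1 + C * d\<^sup>2) * (I - d * J)" using le[OF d] ge0 by (meson mult_right_mono order_trans)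
  also have "\<dots> = I - d * J + C * d\<^sup>2 * I - C * d\<^sup>2 * (d * J)" by (simp add: algebra_simps)
  also have "\<dots> \<le> I - d * J + C * d\<^sup>2 * I" using C d J by simp
  finally have "d * J \<le> d * (C * d * I)" by (simp add: power2_eq_square mult_ac)
  hence "J \<le> C * d * I" using d by simp
  also have "\<dots> \<le> C * (J / (2 * C * (I + 1))) * I" using C I by (intro mult_right_mono mult_left_mono) (auto simp: d_def)
  also have "\<dots> = J * (I / (2 * (I + 1)))" using C by simp
  also have "\<dots> < J * 1" using I J by (intro mult_strict_left_mono) (auto simp: field_simps)
  finally show False by simp
qed

text \<open>
  Shifting the segment of integration by \<open>t\<close> adds a piece of length \<open>t\<close> at its far end and removes one at its near
  end; the hypothesis compares these two pieces.
\<close>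

lemma line_average_decrease:
  fixes G :: "'a::euclidean_space \<Rightarrow> real"
  assumes G: "continuous_on UNIV G" and a: "a \<ge> 0" and t: "t \<ge> 0"
    and dec: "\<And>s. 0 \<le> s \<Longrightarrow> s \<le> t \<Longrightarrow> G (x + (s + a) *\<^sub>R w) \<le> G (x + s *\<^sub>R w) - c"
  shows "integral {0..a} (\<lambda>s. G (x + t *\<^sub>R w + s *\<^sub>R w)) \<le> integral {0..a} (\<lambda>s. G (x + s *\<^sub>R w)) - c * t"
proof -
  define f where "f s = G (x + s *\<^sub>R w)" for s
  have cont: "continuous_on S f" for S unfolding f_def
    by (intro continuous_on_compose2[OF G] continuous_intros) auto
  have int: "f integrable_on {p..q}" for p q by (intro integrable_continuous_real cont)
  have shift: "integral {0..q} (\<lambda>s. f (s + p)) = integral {p..q + p} f" for p q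
    using integral_shift_real_ivl[of p p "q + p" f] by simp
  have "integral {0..a} (\<lambda>s. G (x + t *\<^sub>R w + s *\<^sub>R w)) = integral {t..a + t} f"
    unfolding shift[symmetric] by (simp add: f_def algebra_simps)
  moreover have "integral {0..t} f + integral {t..a + t} f = integral {0..a + t} f"
    using a t by (intro Henstock_Kurzweil_Integration.integral_combine int) auto
  moreover have "integral {0..a} f + integral {a..a + t} f = integral {0..a + t} f"
    using a t by (intro Henstock_Kurzweil_Integration.integral_combine int) auto
  moreover have "integral {a..a + t} f \<le> integral {0..t} f - c * t"
  proof -
    have "integral {a..a + t} f = integral {0..t} (\<lambda>s. f (s + a))" using shift[of t a] by (simp add: add.commute)
    also have "\<dots> \<le> integral {0..t} (\<lambda>s. f s - c)"
    proof (intro integral_le integrable_diff int integrable_const_ivl)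
      show "(\<lambda>s. f (s + a)) integrable_on {0..t}"
        by (intro integrable_continuous_real continuous_on_compose2[OF cont[of UNIV]] continuous_intros) auto
    qed (use dec in \<open>auto simp: f_def\<close>)
    also have "\<dots> = integral {0..t} f - c * t" using t int
      by (subst integral_diff) (auto simp: mult.commute)
    finally show ?thesis .
  qed
  ultimately show ?thesis unfolding f_def[symmetric] by linarith
qed

text \<open>
  If \<open>G\<close> were smaller at \<open>x\<^sub>0 + a *\<^sub>R w\<close> than at \<open>x\<^sub>0\<close>, then by continuity the same would hold, with a gap
  \<open>c\<close>, near \<open>x\<^sub>0\<close>. The segment averages \<open>G2\<close>, which inherit the perimeter inequality, would therefore decrease at rate
  \<open>c\<close> in the direction \<open>w\<close>. On a small disc around \<open>x\<^sub>0\<close> this is a loss of first order in the slope \<open>d\<close>.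
\<close>

lemma monotone_along_axis:
  fixes w :: "'a::euclidean_space" and G :: "'a \<Rightarrow> real"
  assumes dim: "2 \<le> DIM('a)" and w: "norm w = 1" and a: "a > 0"
    and G: "continuous_on UNIV G" "\<And>x. G x \<ge> 0"
    and \<Phi>[measurable]: "\<Phi> \<in> borel_measurable borel"
    and \<Phi>0: "\<Phi> 0 = 0" and \<Phi>M: "\<And>v. norm v = 1 \<Longrightarrow> \<Phi> v \<le> ennreal M" and \<Phi>w: "\<Phi> (- w) = ennreal M" and M: "M > 0"
    and mono: "\<And>r d y. r > 0 \<Longrightarrow> d \<ge> 0 \<Longrightarrow>
       weighted_perimeter (\<lambda>x. ennreal (G (x + y))) \<Phi> (double_cone w r 0)
       \<le> weighted_perimeter (\<lambda>x. ennreal (G (x + y))) \<Phi> (double_cone w r d)"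
  shows "G x\<^sub>0 \<le> G (x\<^sub>0 + a *\<^sub>R w)"
proof (rule ccontr)
  let ?H = "surface_measure :: 'a measure"
  assume neg: "\<not> G x\<^sub>0 \<le> G (x\<^sub>0 + a *\<^sub>R w)"
  define c where "c = (G x\<^sub>0 - G (x\<^sub>0 + a *\<^sub>R w)) / 2"
  have c: "c > 0" using neg by (simp add: c_def)
  have [measurable]: "G \<in> borel_measurable borel" using G(1) by (rule borel_measurable_continuous_onI)
  have "open {x. c < G x - G (x + a *\<^sub>R w)}"
    by (intro open_Collect_less continuous_intros continuous_on_compose2[OF G(1)]) (auto simp: G(1))
  moreover have "x\<^sub>0 \<in> {x. c < G x - G (x + a *\<^sub>R w)}" using neg by (simp add: c_def field_simps)
  ultimately obtain \<eta> where \<eta>: "\<eta> > 0" "ball x\<^sub>0 \<eta> \<subseteq> {x. c < G x - G (x + a *\<^sub>R w)}"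
    by (meson openE)
  define r where "r = \<eta> / 2"
  have r: "r > 0" using \<eta> by (simp add: r_def)
  define G2 where "G2 x = integral {0..a} (\<lambda>s. G (x + s *\<^sub>R w))" for x
  have cont_line: "continuous_on S (\<lambda>s. G (x + s *\<^sub>R w))" for x S
    by (intro continuous_on_compose2[OF G(1)] continuous_intros) auto
  have G2_nonneg: "G2 x \<ge> 0" for x unfolding G2_def
    by (intro integral_nonneg integrable_continuous_real cont_line) (auto simp: G)
  have G2_eq: "ennreal (G2 x) = (\<integral>\<^sup>+s. indicator {0..a} s * ennreal (G (x + s *\<^sub>R w)) \<partial>lborel)" for x
  proof -
    have "((\<lambda>s. G (x + s *\<^sub>R w)) has_integral G2 x) {0..a}" unfolding G2_def
      by (intro integrable_integral integrable_continuous_real cont_line)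
    from nn_integral_has_integral_lebesgue'[OF _ this] show ?thesis
      by (simp add: G mult.commute)
  qed
  have [measurable]: "(\<lambda>x. ennreal (G2 x)) \<in> borel_measurable borel" unfolding G2_eq by measurable
  have dec: "G2 (x + t *\<^sub>R w) \<le> G2 x - c * t" if "dist x x\<^sub>0 < r" "0 \<le> t" "t \<le> r" for x t
    unfolding G2_def
  proof (rule line_average_decrease[OF G(1)])
    fix s assume "0 \<le> s" "s \<le> t"
    have "dist x\<^sub>0 (x + s *\<^sub>R w) \<le> dist x\<^sub>0 x + norm (s *\<^sub>R w)"
      using dist_triangle[of x\<^sub>0 "x + s *\<^sub>R w" x] by (simp add: dist_norm)
    also have "\<dots> < \<eta>" using that \<open>0 \<le> s\<close> \<open>s \<le> t\<close> w by (simp add: r_def dist_commute)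
    finally have "c < G (x + s *\<^sub>R w) - G (x + s *\<^sub>R w + a *\<^sub>R w)" using \<eta>(2) by auto
    thus "G (x + (s + a) *\<^sub>R w) \<le> G (x + s *\<^sub>R w) - c" by (simp add: algebra_simps)
  qed (use a that in auto)
  obtain K where K: "\<And>x. norm x \<le> 2 * r \<Longrightarrow> G2 (x + x\<^sub>0) \<le> K"
  proof -
    have "compact (G ` cball x\<^sub>0 (2 * r + a))"
      by (intro compact_continuous_image continuous_on_subset[OF G(1)]) auto
    then obtain B where B: "\<And>y. y \<in> cball x\<^sub>0 (2 * r + a) \<Longrightarrow> G y \<le> B"
      by (meson bounded_imp_bdd_above compact_imp_bounded bdd_above.E imageI)
    have "G2 (x + x\<^sub>0) \<le> integral {0..a} (\<lambda>_. B)" if x: "norm x \<le> 2 * r" for x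
      unfolding G2_def
    proof (intro integral_le integrable_continuous_real cont_line continuous_on_const B)
      fix s assume s: "s \<in> {0..a}"
      have "dist x\<^sub>0 (x + x\<^sub>0 + s *\<^sub>R w) \<le> norm x + norm (s *\<^sub>R w)"
        using dist_triangle[of x\<^sub>0 "x + x\<^sub>0 + s *\<^sub>R w" "x + x\<^sub>0"] by (simp add: dist_norm)
      thus "x + x\<^sub>0 + s *\<^sub>R w \<in> cball x\<^sub>0 (2 * r + a)" using s x w by simp
    qed
    thus thesis by (rule that)
  qed
  have mono2: "weighted_perimeter (\<lambda>x. ennreal (G2 (x + x\<^sub>0))) \<Phi> (double_cone w r 0)
       \<le> weighted_perimeter (\<lambda>x. ennreal (G2 (x + x\<^sub>0))) \<Phi> (double_cone w r d)" if d: "d \<ge> 0" for d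
  proof -
    have eq: "weighted_perimeter (\<lambda>x. ennreal (G2 (x + x\<^sub>0))) \<Phi> (double_cone w r d) =
       (\<integral>\<^sup>+z. indicator {0..a} z * weighted_perimeter (\<lambda>x. ennreal (G (x + (x\<^sub>0 + z *\<^sub>R w)))) \<Phi> (double_cone w r d) \<partial>lborel)"
      if d: "d \<ge> 0" for d
      unfolding G2_eq
      using weighted_perimeter_average[of "\<lambda>x. ennreal (G x)" \<Phi> lborel "indicator {0..a}" "\<lambda>z. x\<^sub>0 + z *\<^sub>R w" "double_cone w r d"]
        hausdorff_frontier_double_cone_finite[OF w r d] by (simp add: lborel.sigma_finite_measure_axioms add.assoc)
    show ?thesis unfolding eq[OF d] eq[OF order.refl]
      by (intro nn_integral_mono mult_left_mono mono r d) auto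
  qed
  have fin: "emeasure ?H (disc w r) < \<infinity>"
  proof -
    have "disc w r \<subseteq> {x. x \<bullet> w = 0 \<and> norm x \<le> r}" by (auto simp: disc_def)
    hence "hausdorff_outer_measure (DIM('a) - 1) (disc w r) < \<infinity>"
      using order.strict_trans1[OF hausdorff_outer_measure_mono hausdorff_disc_finite[OF w r]] by blast
    thus ?thesis by (simp add: emeasure_hausdorff_measure)
  qed
  have fin_int: "(\<integral>\<^sup>+x\<in>disc w r. ennreal (h x) \<partial>?H) < \<infinity>" if "\<And>x. x \<in> disc w r \<Longrightarrow> h x \<le> B" for h B
  proof -
    have "(\<integral>\<^sup>+x\<in>disc w r. ennreal (h x) \<partial>?H) \<le> (\<integral>\<^sup>+x. ennreal B * indicator (disc w r) x \<partial>?H)"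
      using that by (intro nn_integral_mono) (auto simp: indicator_def intro: ennreal_leI)
    also have "\<dots> < \<infinity>" using fin by (simp add: nn_integral_cmult_indicator ennreal_mult_less_top)
    finally show ?thesis .
  qed
  define I where "I = (\<integral>\<^sup>+x\<in>disc w r. ennreal (G2 (x + x\<^sub>0)) \<partial>?H)"
  define J where "J = (\<integral>\<^sup>+x\<in>disc w r. ennreal (c * (r - norm x)) \<partial>?H)"
  have I_fin: "I < \<infinity>" unfolding I_def using K r by (intro fin_int[of _ K]) (auto simp: disc_def)
  have J_fin: "J < \<infinity>" unfolding J_def using c by (intro fin_int[of _ "c * r"]) auto
  have J_pos: "J > 0"
  proof -
    have "ennreal (c * (r / 2)) * emeasure ?H (disc w (r / 2)) > 0"
      using hausdorff_disc_pos[OF dim w, of "r / 2", folded disc_def] c r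
      by (simp add: emeasure_hausdorff_measure ennreal_zero_less_mult_iff)
    also have "ennreal (c * (r / 2)) * emeasure ?H (disc w (r / 2)) = (\<integral>\<^sup>+x. ennreal (c * (r / 2)) * indicator (disc w (r / 2)) x \<partial>?H)"
      by (simp add: nn_integral_cmult_indicator)
    also have "\<dots> \<le> J" unfolding J_def
      using c r by (intro nn_integral_mono) (auto simp: indicator_def disc_def intro!: ennreal_leI mult_left_mono)
    finally show ?thesis .
  qed
  show False
  proof (rule no_first_order_gain[of "enn2real I" "enn2real J" "DIM('a) - 1"])
    show "enn2real J > 0" using J_pos J_fin by (simp add: enn2real_positive_iff)
    fix d :: real assume d: "0 < d" "d < 1"
    define I' where "I' = (\<integral>\<^sup>+x\<in>disc w r. ennreal (G2 (lift w r d x + x\<^sub>0)) \<partial>?H)"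
    have [measurable]: "lift w r d \<in> borel_measurable borel"
      unfolding lift_def by (intro borel_measurable_continuous_onI continuous_intros)
    have le: "I \<le> ennreal ((1 + d\<^sup>2) ^ (DIM('a) - 1)) * I'"
      unfolding I_def I'_def using d M r K
      by (intro disc_integral_le_lift[where \<Phi> = \<Phi> and M = M and K = K] w \<Phi> \<Phi>0 \<Phi>M \<Phi>w mono2) (auto intro: ennreal_leI)
    have "I' + ennreal d * J = (\<integral>\<^sup>+x. ennreal (G2 (lift w r d x + x\<^sub>0)) * indicator (disc w r) x
         + ennreal d * (ennreal (c * (r - norm x)) * indicator (disc w r) x) \<partial>?H)"
      unfolding I'_def J_def by (subst nn_integral_add) (simp_all add: nn_integral_cmult)
    also have "\<dots> \<le> I" unfolding I_def
    proof (intro nn_integral_mono)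
      fix x
      show "ennreal (G2 (lift w r d x + x\<^sub>0)) * indicator (disc w r) x
         + ennreal d * (ennreal (c * (r - norm x)) * indicator (disc w r) x)
         \<le> ennreal (G2 (x + x\<^sub>0)) * indicator (disc w r) x"
      proof (cases "x \<in> disc w r")
        case True
        hence x: "norm x < r" by (simp add: disc_def)
        have "d * (r - norm x) \<le> 1 * r" using d x by (intro mult_mono) auto
        hence "G2 ((x + x\<^sub>0) + (d * (r - norm x)) *\<^sub>R w) \<le> G2 (x + x\<^sub>0) - c * (d * (r - norm x))"
          using x d by (intro dec) (auto simp: dist_norm)
        hence "G2 (lift w r d x + x\<^sub>0) + d * (c * (r - norm x)) \<le> G2 (x + x\<^sub>0)"
          by (simp add: lift_def algebra_simps)
        moreover have "ennreal (G2 (lift w r d x + x\<^sub>0)) + ennreal d * ennreal (c * (r - norm x)) =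
           ennreal (G2 (lift w r d x + x\<^sub>0) + d * (c * (r - norm x)))"
          using G2_nonneg d c x by (simp add: ennreal_mult)
        ultimately show ?thesis using True by (simp add: ennreal_leI)
      qed simp
    qed
    finally have le2: "I' + ennreal d * J \<le> I" .
    obtain i j i' where reals: "I = ennreal i" "J = ennreal j" "I' = ennreal i'" "i \<ge> 0" "j \<ge> 0" "i' \<ge> 0"
      using I_fin J_fin le2 by (cases I; cases J; cases I') (auto simp: top_unique)
    have "i' + d * j \<le> i" using le2 d unfolding reals
      by (subst (asm) ennreal_mult[symmetric]) (auto simp: reals simp flip: ennreal_plus)
    moreover have "i \<le> (1 + d\<^sup>2) ^ (DIM('a) - 1) * i'" using le unfolding reals
      by (subst (asm) ennreal_mult[symmetric]) (auto simp: reals)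
    ultimately have "i \<le> (1 + d\<^sup>2) ^ (DIM('a) - 1) * (i - d * j)"
      by (meson add_le_imp_le_diff mult_left_mono order_trans zero_le_power add_nonneg_nonneg zero_le_one zero_le_power2)
    thus "enn2real I \<le> (1 + d\<^sup>2) ^ (DIM('a) - 1) * (enn2real I - d * enn2real J)"
      using reals by simp
  qed simp
qed

section \<open>Ball masses\<close>

lemma measurable_ball_cball [measurable]:
  "ball x e \<in> sets borel" "cball x e \<in> sets borel"
  by auto

lemma nn_integral_lborel_translate:
  fixes h :: "'a::euclidean_space \<Rightarrow> ennreal"
  assumes [measurable]: "h \<in> borel_measurable borel"
  shows "(\<integral>\<^sup>+x. h (c + x) \<partial>lborel) = (\<integral>\<^sup>+x. h x \<partial>lborel)"
  by (subst (2) lborel_distr_plus[of c, symmetric]) (simp add: nn_integral_distr)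

text \<open>
  Integrate the indicator of \<open>z \<in> S\<close> and \<open>z - x \<in> ball 0 1\<close> against \<open>\<mu>\<close> in \<open>x\<close> and Lebesgue measure in \<open>z\<close>. One order
  of integration gives the volume of \<open>S\<close> times \<open>\<mu>\<close> of the ball, and the substitution \<open>z = x + y\<close> gives
  \<open>\<mu>\<close> of \<open>S\<close> times the volume of the ball.
\<close>

lemma translation_invariant_eq_lborel:
  fixes \<mu> :: "'a::euclidean_space measure"
  assumes sets [measurable_cong, simp]: "sets \<mu> = sets borel" and fin: "sigma_finite_measure \<mu>"
    and inv: "\<And>S y. S \<in> sets borel \<Longrightarrow> emeasure \<mu> ((\<lambda>x. x + y) -` S) = emeasure \<mu> S"
    and unit: "emeasure \<mu> (ball 0 1) = emeasure lborel (ball (0::'a) 1)"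
  shows "\<mu> = lborel"
proof (rule measure_eqI)
  fix S assume "S \<in> sets \<mu>"
  hence S [measurable]: "S \<in> sets borel" by simp
  interpret M: sigma_finite_measure \<mu> by fact
  interpret P: pair_sigma_finite \<mu> lborel ..
  interpret Q: pair_sigma_finite lborel \<mu> ..
  have space [simp]: "space \<mu> = UNIV" using sets_eq_imp_space_eq[OF sets] by simp
  let ?B = "ball (0::'a) 1"
  have "emeasure lborel S * emeasure \<mu> ?B = (\<integral>\<^sup>+z. indicator S z * emeasure \<mu> ?B \<partial>lborel)"
    by (simp add: nn_integral_multc)
  also have "\<dots> = (\<integral>\<^sup>+z. indicator S z * (\<integral>\<^sup>+x. indicator ?B (z - x) \<partial>\<mu>) \<partial>lborel)"
  proof (intro nn_integral_cong arg_cong2[where f = "(*)"] refl)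
    fix z :: 'a
    have "(\<integral>\<^sup>+x. indicator ?B (z - x) \<partial>\<mu>) = (\<integral>\<^sup>+x. indicator ((\<lambda>x. x + (- z)) -` ?B) x \<partial>\<mu>)"
      by (intro nn_integral_cong) (simp add: indicator_def norm_minus_commute)
    also have "\<dots> = emeasure \<mu> ((\<lambda>x. x + (- z)) -` ?B)"
      by (subst nn_integral_indicator)
        (auto intro!: measurable_sets[of "\<lambda>x. x + (- z)" borel borel, simplified])
    finally show "emeasure \<mu> ?B = (\<integral>\<^sup>+x. indicator ?B (z - x) \<partial>\<mu>)" by (simp only: inv borel_open open_ball)
  qed
  also have "\<dots> = (\<integral>\<^sup>+z. (\<integral>\<^sup>+x. indicator S z * indicator ?B (z - x) \<partial>\<mu>) \<partial>lborel)"
    by (intro nn_integral_cong nn_integral_cmult[symmetric]) measurable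
  also have "\<dots> = (\<integral>\<^sup>+x. (\<integral>\<^sup>+z. indicator S z * indicator ?B (z - x) \<partial>lborel) \<partial>\<mu>)"
    by (rule P.Fubini') measurable
  also have "\<dots> = (\<integral>\<^sup>+x. (\<integral>\<^sup>+y. indicator S (x + y) * indicator ?B y \<partial>lborel) \<partial>\<mu>)"
  proof (rule nn_integral_cong)
    fix x :: 'a
    show "(\<integral>\<^sup>+z. indicator S z * indicator ?B (z - x) \<partial>lborel) = (\<integral>\<^sup>+y. indicator S (x + y) * (indicator ?B y :: ennreal) \<partial>lborel)"
      using nn_integral_lborel_translate[of "\<lambda>z. indicator S z * indicator ?B (z - x)" x] by simp
  qed
  also have "\<dots> = (\<integral>\<^sup>+y. (\<integral>\<^sup>+x. indicator S (x + y) * indicator ?B y \<partial>\<mu>) \<partial>lborel)"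
    by (rule Q.Fubini') measurable
  also have "\<dots> = (\<integral>\<^sup>+y. emeasure \<mu> S * indicator ?B y \<partial>lborel)"
  proof (intro nn_integral_cong)
    fix y :: 'a
    have "(\<integral>\<^sup>+x. indicator S (x + y) * indicator ?B y \<partial>\<mu>) = (\<integral>\<^sup>+x. indicator S (x + y) \<partial>\<mu>) * indicator ?B y"
      by (rule nn_integral_multc) measurable
    also have "(\<integral>\<^sup>+x. indicator S (x + y) \<partial>\<mu>) = (\<integral>\<^sup>+x. indicator ((\<lambda>x. x + y) -` S) x \<partial>\<mu>)"
      by (intro nn_integral_cong) (simp add: indicator_def)
    also have "\<dots> = emeasure \<mu> ((\<lambda>x. x + y) -` S)"
      by (subst nn_integral_indicator)
        (auto intro!: measurable_sets[of "\<lambda>x. x + y" borel borel, simplified])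
    finally show "(\<integral>\<^sup>+x. indicator S (x + y) * indicator ?B y \<partial>\<mu>) = emeasure \<mu> S * indicator ?B y"
      by (simp add: inv)
  qed
  also have "\<dots> = emeasure \<mu> S * emeasure lborel ?B" by (rule nn_integral_cmult_indicator) simp
  finally have "emeasure lborel S * emeasure lborel ?B = emeasure \<mu> S * emeasure lborel ?B"
    by (simp only: unit)
  moreover have "unit_ball_vol (real DIM('a)) \<noteq> 0" using unit_ball_vol_pos[of "real DIM('a)"] by linarith
  hence "emeasure lborel ?B \<noteq> 0" "emeasure lborel ?B \<noteq> top" by (auto simp: emeasure_ball)
  ultimately show "emeasure \<mu> S = emeasure lborel S"
    by (metis ennreal_mult_divide_eq)
qed simp

text \<open>
  The image measure is translation invariant and gives the unit ball, which is mapped to itself, its volume.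
\<close>

lemma distr_lborel_orthogonal:
  fixes R :: "'a::euclidean_space \<Rightarrow> 'a"
  assumes R: "orthogonal_transformation R"
  shows "distr lborel borel R = lborel"
proof (rule translation_invariant_eq_lborel)
  have lin: "linear R" using R by (rule orthogonal_transformation_linear)
  have [measurable]: "R \<in> borel_measurable borel"
    using lin by (intro borel_measurable_continuous_onI linear_continuous_on linear_conv_bounded_linear[THEN iffD1])
  have nR: "norm (R x) = norm x" for x using R by (rule orthogonal_transformation_norm)
  have pre_ball: "R -` ball 0 r = ball 0 r" for r by (auto simp: nR)
  show "sigma_finite_measure (distr lborel borel R)"
  proof (unfold_locales, intro exI conjI)
    let ?A = "range (\<lambda>n. ball (0::'a) (real n))"
    show "countable ?A" by simp
    show "?A \<subseteq> sets (distr lborel borel R)" by auto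
    show "\<Union> ?A = space (distr lborel borel R)" using reals_Archimedean2 by auto
    show "\<forall>a\<in>?A. emeasure (distr lborel borel R) a \<noteq> \<infinity>"
      by (auto simp: emeasure_distr pre_ball emeasure_ball)
  qed
  show "emeasure (distr lborel borel R) (ball 0 1) = emeasure lborel (ball (0::'a) 1)"
    by (simp add: emeasure_distr pre_ball)
  fix S :: "'a set" and y assume [measurable]: "S \<in> sets borel"
  obtain u where u: "y = R u" using orthogonal_transformation_surj[OF R] by blast
  have pre: "(\<lambda>x. x + y) -` S \<in> sets borel" 
    using measurable_sets[of "\<lambda>x. x + y" borel borel S] by simp
  have RS: "R -` S \<in> sets borel" using measurable_sets[of R borel borel S] by simp
  have "emeasure (distr lborel borel R) ((\<lambda>x. x + y) -` S) = emeasure lborel ((\<lambda>x. u + x) -` (R -` S))"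
    using pre by (simp add: emeasure_distr u linear_add[OF lin] vimage_def add.commute)
  also have "\<dots> = emeasure (distr lborel borel ((+) u)) (R -` S)"
    using RS by (simp add: emeasure_distr)
  also have "\<dots> = emeasure (distr lborel borel R) S" by (simp add: lborel_distr_plus emeasure_distr)
  finally show "emeasure (distr lborel borel R) ((\<lambda>x. x + y) -` S) = emeasure (distr lborel borel R) S" .
qed simp

definition ball_mass :: "('a::euclidean_space \<Rightarrow> ennreal) \<Rightarrow> real \<Rightarrow> 'a \<Rightarrow> ennreal" where
  "ball_mass g e x = (\<integral>\<^sup>+y. indicator (ball 0 e) y * g (x + y) \<partial>lborel)"

lemma ball_mass_eq:
  assumes [measurable]: "g \<in> borel_measurable borel"
  shows "ball_mass g e x = (\<integral>\<^sup>+z. indicator (ball x e) z * g z \<partial>lborel)"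
proof -
  have "(\<integral>\<^sup>+z. indicator (ball x e) z * g z \<partial>lborel) = (\<integral>\<^sup>+z. indicator (ball x e) (x + z) * g (x + z) \<partial>lborel)"
    by (rule nn_integral_lborel_translate[symmetric]) measurable
  thus ?thesis unfolding ball_mass_def by (simp add: indicator_def dist_norm)
qed

lemma borel_measurable_ball_mass [measurable]:
  assumes [measurable]: "g \<in> borel_measurable borel"
  shows "ball_mass g e \<in> borel_measurable borel"
  unfolding ball_mass_def by measurable

lemma ball_mass_finite:
  assumes [measurable]: "g \<in> borel_measurable borel"
    and fin: "\<And>a. (\<integral>\<^sup>+z. indicator (cball 0 a) z * g z \<partial>lborel) < \<infinity>"
  shows "ball_mass g e x < \<infinity>"
proof -
  have "ball_mass g e x \<le> (\<integral>\<^sup>+z. indicator (cball 0 (norm x + e)) z * g z \<partial>lborel)"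
    unfolding ball_mass_eq[OF assms(1)]
  proof (intro nn_integral_mono)
    fix z show "indicator (ball x e) z * g z \<le> indicator (cball 0 (norm x + e)) z * g z"
      using norm_triangle_ineq2[of z x] by (auto simp: indicator_def dist_norm norm_minus_commute)
  qed
  thus ?thesis using fin by (rule order_le_less_trans)
qed

text \<open>
  Dominated convergence: the indicators of the balls converge off a sphere, which is a null set.
\<close>

lemma continuous_on_ball_mass:
  fixes g :: "'a::euclidean_space \<Rightarrow> ennreal"
  assumes g[measurable]: "g \<in> borel_measurable borel"
    and fin: "\<And>a. (\<integral>\<^sup>+z. indicator (cball 0 a) z * g z \<partial>lborel) < \<infinity>"
  shows "continuous_on UNIV (\<lambda>x. enn2real (ball_mass g e x))"
  unfolding continuous_on_sequentially
proof (intro allI ballI impI)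
  fix X :: "nat \<Rightarrow> 'a" and x assume "(\<forall>n. X n \<in> UNIV) \<and> X \<longlonglongrightarrow> x"
  hence lim: "X \<longlonglongrightarrow> x" by simp
  obtain R where R: "\<And>n. norm (X n) \<le> R"
    using convergent_imp_bounded[OF lim] by (auto simp: bounded_iff)
  have "(\<lambda>n. \<integral>\<^sup>+z. indicator (ball (X n) e) z * g z \<partial>lborel) \<longlonglongrightarrow> (\<integral>\<^sup>+z. indicator (ball x e) z * g z \<partial>lborel)"
  proof (rule nn_integral_dominated_convergence)
    show "AE z in lborel. indicator (ball (X n) e) z * g z \<le> indicator (cball 0 (R + e)) z * g z" for n
    proof (intro AE_I2)
      fix z show "indicator (ball (X n) e) z * g z \<le> indicator (cball 0 (R + e)) z * g z"
        using norm_triangle_ineq2[of z "X n"] R[of n]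
        by (auto simp: indicator_def dist_norm norm_minus_commute)
    qed
    have "sphere x e \<in> null_sets lborel"
      using negligible_sphere[of x e] by (simp add: null_sets_completion_iff negligible_iff_null_sets)
    hence "AE z in lborel. z \<notin> sphere x e" by (rule AE_not_in)
    thus "AE z in lborel. (\<lambda>n. indicator (ball (X n) e) z * g z) \<longlonglongrightarrow> indicator (ball x e) z * g z"
    proof eventually_elim
      case (elim z)
      have d: "(\<lambda>n. dist (X n) z) \<longlonglongrightarrow> dist x z" by (intro tendsto_intros lim)
      consider "dist x z < e" | "dist x z > e" using elim by force
      hence "eventually (\<lambda>n. indicator (ball (X n) e) z = (indicator (ball x e) z :: ennreal)) sequentially"
      proof cases
        case 1
        from order_tendstoD(2)[OF d 1] show ?thesis by eventually_elim (use 1 in auto)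
      next
        case 2
        from order_tendstoD(1)[OF d 2] show ?thesis by eventually_elim (use 2 in auto)
      qed
      hence "eventually (\<lambda>n. indicator (ball (X n) e) z * g z = indicator (ball x e) z * g z) sequentially"
        by eventually_elim simp
      thus ?case by (rule tendsto_eventually)
    qed
    show "(\<integral>\<^sup>+z. indicator (cball 0 (R + e)) z * g z \<partial>lborel) < \<infinity>" by (rule fin)
  qed measurable
  hence "(\<lambda>n. ball_mass g e (X n)) \<longlonglongrightarrow> ball_mass g e x" by (simp only: ball_mass_eq[OF g])
  hence "(\<lambda>n. ball_mass g e (X n)) \<longlonglongrightarrow> ennreal (enn2real (ball_mass g e x))"
    using ball_mass_finite[OF g fin, of e x] by (simp add: less_top)
  thus "((\<lambda>x. enn2real (ball_mass g e x)) \<circ> X) \<longlonglongrightarrow> enn2real (ball_mass g e x)"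
    unfolding comp_def by (rule tendsto_enn2real) simp
qed

lemma ball_mass_radial:
  fixes g :: "real ^ 'n \<Rightarrow> ennreal"
  assumes g[measurable]: "g \<in> borel_measurable borel" and rad: "radial g" and eq: "norm x = norm y"
  shows "ball_mass g e x = ball_mass g e y"
proof -
  obtain R where R: "orthogonal_transformation R" "R x = y" using orthogonal_transformation_exists[OF eq] .
  have lin: "linear R" using R by (intro orthogonal_transformation_linear)
  have [measurable]: "R \<in> borel_measurable borel"
    using lin by (intro borel_measurable_continuous_onI linear_continuous_on linear_conv_bounded_linear[THEN iffD1])
  have nR: "norm (R x) = norm x" for x using R(1) by (rule orthogonal_transformation_norm)
  have "ball_mass g e y = (\<integral>\<^sup>+z. indicator (ball 0 e) z * g (y + z) \<partial>distr lborel borel R)"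
    by (simp add: ball_mass_def distr_lborel_orthogonal[OF R(1)])
  also have "\<dots> = (\<integral>\<^sup>+z. indicator (ball 0 e) (R z) * g (y + R z) \<partial>lborel)"
    by (rule nn_integral_distr) simp_all
  also have "\<dots> = (\<integral>\<^sup>+z. indicator (ball 0 e) z * g (x + z) \<partial>lborel)"
  proof (intro nn_integral_cong)
    fix z
    have "y + R z = R (x + z)" by (simp add: linear_add[OF lin] R(2))
    hence "g (y + R z) = g (x + z)" using rad nR unfolding radial_def by metis
    thus "indicator (ball 0 e) (R z) * g (y + R z) = indicator (ball 0 e) z * g (x + z)"
      by (simp add: indicator_def nR)
  qed
  finally show ?thesis by (simp add: ball_mass_def)
qed

text \<open>
  The masses are proportional to the volumes of the balls: integrating the mass of the balls of radius \<open>e\<close> over a ball of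
  radius \<open>d\<close> is symmetric in \<open>e\<close> and \<open>d\<close>. By Vitali's covering theorem every open set is, up to a null set, a
  countable disjoint union of balls, so the measure with density \<open>g\<close> is a multiple of Lebesgue measure.
\<close>

lemma AE_const_if_ball_mass_const:
  fixes g :: "'a::euclidean_space \<Rightarrow> ennreal"
  assumes g[measurable]: "g \<in> borel_measurable borel"
    and fin: "\<And>a. (\<integral>\<^sup>+z. indicator (cball 0 a) z * g z \<partial>lborel) < \<infinity>"
    and const: "\<And>e x. e > 0 \<Longrightarrow> ball_mass g e x = ball_mass g e 0"
  shows "\<exists>c::real. c \<ge> 0 \<and> (AE x in lborel. g x = ennreal c)"
proof -
  define m where "m e = ball_mass g e 0" for e
  let ?B = "\<lambda>e. emeasure lborel (ball (0::'a) e)"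
  have "unit_ball_vol (real DIM('a)) \<noteq> 0" using unit_ball_vol_pos[of "real DIM('a)"] by linarith
  hence B: "?B e \<noteq> 0" "?B e \<noteq> top" if "e > 0" for e using that by (auto simp: emeasure_ball)
  have cross: "m e * ?B d = m d * ?B e" if ed: "e > 0" "d > 0" for e d
  proof -
    \<comment> \<open>the right-hand side becomes symmetric in \<open>e\<close> and \<open>d\<close> by Tonelli\<close>
    have *: "m e * ?B d = (\<integral>\<^sup>+z. (\<integral>\<^sup>+y. indicator (ball 0 d) z * (indicator (ball 0 e) y * g (z + y)) \<partial>lborel) \<partial>lborel)"
      if "e > 0" "d > 0" for e d
    proof -
      have "m e * ?B d = (\<integral>\<^sup>+z. m e * indicator (ball (0::'a) d) z \<partial>lborel)"
        by (simp add: nn_integral_cmult_indicator)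
      also have "\<dots> = (\<integral>\<^sup>+z. indicator (ball 0 d) z * ball_mass g e z \<partial>lborel)"
      proof (rule nn_integral_cong)
        fix z :: 'a
        show "m e * indicator (ball 0 d) z = indicator (ball 0 d) z * ball_mass g e z"
          unfolding m_def const[OF that(1), of z] by (rule mult.commute)
      qed
      also have "\<dots> = (\<integral>\<^sup>+z. (\<integral>\<^sup>+y. indicator (ball 0 d) z * (indicator (ball 0 e) y * g (z + y)) \<partial>lborel) \<partial>lborel)"
        unfolding ball_mass_def by (intro nn_integral_cong nn_integral_cmult[symmetric]) measurable
      finally show ?thesis .
    qed
    show ?thesis unfolding *[OF ed] *[OF ed(2,1)]
      by (subst lborel_pair.Fubini') (auto simp: mult_ac add.commute intro!: nn_integral_cong)
  qed
  define c where "c = enn2real (m 1 / ?B 1)"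
  have m1: "m 1 < \<infinity>" unfolding m_def by (rule ball_mass_finite[OF g fin])
  have "m 1 / ?B 1 < top" using m1 B[of 1] by (simp add: ennreal_divide_eq_top_iff less_top[symmetric])
  hence cc: "ennreal c = m 1 / ?B 1" by (simp add: c_def)
  have mass: "m e = ennreal c * ?B e" if "e > 0" for e
  proof -
    have "m e = m e * ?B 1 / ?B 1" using B[of 1] by (simp add: ennreal_mult_divide_eq)
    also have "\<dots> = m 1 * ?B e / ?B 1" using cross[OF that, of 1] by simp
    also have "\<dots> = ennreal c * ?B e" by (simp add: cc ennreal_divide_times ennreal_times_divide mult.commute)
    finally show ?thesis .
  qed
  let ?M = "density lborel g" and ?N = "density lborel (\<lambda>_::'a. ennreal c)"
  have balls: "emeasure ?M (ball x e) = emeasure ?N (ball x e)" if "e > 0" for x e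
  proof -
    have "emeasure ?M (ball x e) = ball_mass g e x"
      by (simp add: emeasure_density ball_mass_eq mult.commute)
    also have "\<dots> = ennreal c * ?B e" using const[OF that] mass[OF that] by (simp add: m_def)
    also have "\<dots> = emeasure ?N (ball x e)" using that by (simp add: emeasure_density_const emeasure_ball)
    finally show ?thesis .
  qed
  have opens: "emeasure ?M U = emeasure ?N U" if U: "open U" for U
  proof -
    define K where "K = {p::'a \<times> real. snd p > 0 \<and> ball (fst p) (snd p) \<subseteq> U}"
    have "\<exists>p. p \<in> K \<and> x \<in> ball (fst p) (snd p) \<and> snd p < d" if "x \<in> U" "d > 0" for x d
    proof -
      obtain e where e: "e > 0" "ball x e \<subseteq> U" using U \<open>x \<in> U\<close> by (auto simp: open_contains_ball)
      have "ball x (min e (d/2)) \<subseteq> U" using e(2) by (auto simp: subset_iff)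
      thus ?thesis using e(1) \<open>d > 0\<close> by (intro exI[of _ "(x, min e (d/2))"]) (auto simp: K_def)
    qed
    then obtain C where C: "countable C" "C \<subseteq> K" "pairwise (\<lambda>i j. disjnt (ball (fst i) (snd i)) (ball (fst j) (snd j))) C"
      "negligible (U - (\<Union>i\<in>C. ball (fst i) (snd i)))"
      by (rule Vitali_covering_theorem_balls[of U K fst snd])
    let ?W = "\<Union>i\<in>C. ball (fst i) (snd i)"
    have W: "open ?W" "?W \<subseteq> U" using C(2) by (auto simp: K_def)
    have "U - ?W \<in> sets borel" using U W by auto
    hence null: "U - ?W \<in> null_sets lborel"
      using C(4) by (simp add: null_sets_completion_iff negligible_iff_null_sets)
    have disj: "disjoint_family_on (\<lambda>i. ball (fst i) (snd i)) C"
      using C(3) by (auto simp: disjoint_family_on_def pairwise_def disjnt_def)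
    have split: "emeasure D U = (\<integral>\<^sup>+i. emeasure D (ball (fst i) (snd i)) \<partial>count_space C)"
      if D: "D = density lborel h" "h \<in> borel_measurable borel" for D :: "'a measure" and h
    proof -
      have "U - ?W \<in> null_sets D"
        unfolding D(1) using AE_not_in[OF null] null D(2)
        by (subst null_sets_density_iff) (auto elim!: eventually_mono)
      hence "emeasure D (?W \<union> (U - ?W)) = emeasure D ?W" using D W by (intro emeasure_Un_null_set) auto
      also have "?W \<union> (U - ?W) = U" using W by blast
      also have "emeasure D ?W = (\<integral>\<^sup>+i. emeasure D (ball (fst i) (snd i)) \<partial>count_space C)"
        using C(1) disj D by (intro emeasure_UN_countable) auto
      finally show ?thesis .
    qed
    have const: "(\<lambda>_::'a. ennreal c) \<in> borel_measurable borel" by simp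
    show ?thesis
      unfolding split[OF refl g] split[OF refl const]
      using C(2) by (intro nn_integral_cong balls) (auto simp: K_def)
  qed
  have "?M = ?N"
  proof (rule measure_eqI_generator_eq)
    let ?E = "range (\<lambda>(a, b). box a b::'a set)"
    show "Int_stable ?E" by (auto simp: Int_stable_def box_Int_box)
    show "?E \<subseteq> Pow UNIV" "sets ?M = sigma_sets UNIV ?E" "sets ?N = sigma_sets UNIV ?E"
      by (simp_all add: borel_eq_box)
    let ?A = "\<lambda>n::nat. box (- (real n *\<^sub>R One)) (real n *\<^sub>R One) :: 'a set"
    show "range ?A \<subseteq> ?E" "(\<Union>i. ?A i) = UNIV" unfolding UN_box_eq_UNIV by auto
    show "emeasure ?M X = emeasure ?N X" if "X \<in> ?E" for X using that opens open_box by auto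
    show "emeasure ?M (?A i) \<noteq> \<infinity>" for i
      unfolding opens[OF open_box] by (simp add: emeasure_density_const ennreal_mult_eq_top_iff)
  qed
  hence "AE x in lborel. g x = ennreal c"
    by (subst (asm) sigma_finite_measure.density_unique_iff[OF sigma_finite_lborel]) auto
  thus ?thesis by (intro exI[of _ c]) (simp add: c_def)
qed

section \<open>Finiteness of the anisotropy and the conclusion\<close>

lemma borel_measurable_lower_semicontinuous:
  fixes \<Phi> :: "'a::topological_space \<Rightarrow> ennreal"
  assumes "lower_semicontinuous \<Phi>"
  shows "\<Phi> \<in> borel_measurable borel"
proof (rule borel_measurableI_greater)
  fix c
  have "open {x. c < \<Phi> x}"
  proof (subst open_subopen, rule ballI)
    fix x assume "x \<in> {x. c < \<Phi> x}"
    hence c: "c < \<Phi> x" by simp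
    also have "\<Phi> x \<le> Liminf (at x) \<Phi>" using assms by (simp add: lower_semicontinuous_def)
    finally have "eventually (\<lambda>y. c < \<Phi> y) (at x)" 
      by (metis less_LiminfD)
    hence "eventually (\<lambda>y. c < \<Phi> y) (nhds x)" using c by (simp add: eventually_nhds_conv_at)
    thus "\<exists>T. open T \<and> x \<in> T \<and> T \<subseteq> {x. c < \<Phi> x}" by (auto simp: eventually_nhds)
  qed
  thus "{x \<in> space borel. c < \<Phi> x} \<in> sets borel" by simp
qed

text \<open>
  Local integrability of the product bounds \<open>g\<close> and \<open>\<Phi>\<close> separately as soon as neither of them vanishes almost
  everywhere.
\<close>

lemma locally_integrable_product_finite:
  fixes f :: "'a::euclidean_space \<times> 'a \<Rightarrow> ennreal"
  assumes f: "f \<in> borel_measurable borel" "locally_integrable f" "\<And>x v. f (x, v) = g x * \<Phi> v"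
    and [measurable]: "g \<in> borel_measurable borel" "\<Phi> \<in> borel_measurable borel"
  shows "(\<integral>\<^sup>+x. indicator (cball 0 a) x * g x \<partial>lborel) * (\<integral>\<^sup>+v. indicator (cball 0 b) v * \<Phi> v \<partial>lborel) < \<infinity>"
proof -
  let ?K = "cball (0::'a) a \<times> cball (0::'a) b"
  have "(\<integral>\<^sup>+x. indicator (cball 0 a) x * g x \<partial>lborel) * (\<integral>\<^sup>+v. indicator (cball 0 b) v * \<Phi> v \<partial>lborel)
     = (\<integral>\<^sup>+x. (\<integral>\<^sup>+v. f (x, v) * indicator ?K (x, v) \<partial>lborel) \<partial>lborel)"
    by (simp add: f(3) indicator_times nn_integral_cmult nn_integral_multc mult_ac flip: nn_integral_cmult nn_integral_multc)
  also have "\<dots> = (\<integral>\<^sup>+p. f p * indicator ?K p \<partial>(lborel \<Otimes>\<^sub>M lborel))"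
  proof (rule lborel.nn_integral_fst)
    have [measurable]: "?K \<in> sets borel" by (intro borel_closed closed_Times closed_cball)
    have "(\<lambda>p. f p * indicator ?K p) \<in> borel_measurable borel" using f(1) by measurable
    thus "(\<lambda>p. f p * indicator ?K p) \<in> borel_measurable (lborel \<Otimes>\<^sub>M lborel)" by (simp add: lborel_prod)
  qed
  also have "\<dots> = (\<integral>\<^sup>+p\<in>?K. f p \<partial>lebesgue)" by (simp add: lborel_prod nn_integral_completion)
  also have "\<dots> < \<infinity>" using f(2) unfolding locally_integrable_def by (simp add: compact_Times)
  finally show ?thesis .
qed

lemma distr_lborel_uminus_plus:
  fixes v :: "'a::euclidean_space"
  shows "distr lborel borel (\<lambda>x. v - x) = lborel"
  using lborel_affine[of "-1" v] by (simp add: density_1)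

text \<open>
  Almost every \<open>z\<close> lies in the finiteness domain together with its reflection \<open>2 *\<^sub>R v - z\<close>, and \<open>v\<close> is their
  midpoint.
\<close>

lemma ennreal_convex_finite:
  fixes \<Phi> :: "'a::euclidean_space \<Rightarrow> ennreal"
  assumes conv: "ennreal_convex \<Phi>" and [measurable]: "\<Phi> \<in> borel_measurable borel"
    and fin: "AE v in lborel. \<Phi> v < \<infinity>"
  shows "\<Phi> v < \<infinity>"
proof -
  have "AE z in distr lborel borel (\<lambda>z. 2 *\<^sub>R v - z). \<Phi> z < \<infinity>"
    unfolding distr_lborel_uminus_plus by (rule fin)
  hence "AE z in lborel. \<Phi> (2 *\<^sub>R v - z) < \<infinity>" by (subst (asm) AE_distr_iff) auto
  hence "AE z in lborel. \<Phi> (2 *\<^sub>R v - z) < \<infinity> \<and> \<Phi> z < \<infinity>" using fin by eventually_elim simp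
  moreover have "ae_filter (lborel :: 'a measure) \<noteq> bot" by (simp add: ae_filter_eq_bot_iff)
  ultimately obtain z where z: "\<Phi> (2 *\<^sub>R v - z) < \<infinity>" "\<Phi> z < \<infinity>"
    using eventually_happens' by blast
  have "\<Phi> ((1/2) *\<^sub>R (2 *\<^sub>R v - z) + (1/2) *\<^sub>R z) \<le> ennreal (1/2) * \<Phi> (2 *\<^sub>R v - z) + ennreal (1/2) * \<Phi> z"
    using conv[unfolded ennreal_convex_def, rule_format, of "1/2" "1/2" "2 *\<^sub>R v - z" z] by simp
  also have "\<dots> < \<infinity>" using z ennreal_less_top[of "1/2"] by (simp add: ennreal_mult_less_top)
  also have "(1/2) *\<^sub>R (2 *\<^sub>R v - z) + (1/2) *\<^sub>R z = v" by (simp add: algebra_simps)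
  finally show ?thesis .
qed

lemma ennreal_convex_continuous:
  fixes \<Phi> :: "'a::euclidean_space \<Rightarrow> ennreal"
  assumes conv: "ennreal_convex \<Phi>" and fin: "\<And>v. \<Phi> v < \<infinity>"
  shows "continuous_on UNIV (\<lambda>v. enn2real (\<Phi> v))"
proof (rule convex_on_continuous)
  have eq: "\<Phi> v = ennreal (enn2real (\<Phi> v))" for v using fin[of v] by simp
  show "convex_on UNIV (\<lambda>v. enn2real (\<Phi> v))"
  proof (rule convex_onI)
    fix t :: real and x y :: 'a assume t: "0 < t" "t < 1"
    have "\<Phi> ((1 - t) *\<^sub>R x + t *\<^sub>R y) \<le> ennreal (1 - t) * \<Phi> x + ennreal t * \<Phi> y"
      using conv t unfolding ennreal_convex_def by simp
    also have "\<dots> = ennreal ((1 - t) * enn2real (\<Phi> x) + t * enn2real (\<Phi> y))"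
      using t by (subst (1 2) eq) (simp add: ennreal_mult)
    finally show "enn2real (\<Phi> ((1 - t) *\<^sub>R x + t *\<^sub>R y)) \<le> (1 - t) * enn2real (\<Phi> x) + t * enn2real (\<Phi> y)"
      using t by (intro enn2real_leI) auto
  qed simp
qed simp

lemma ball_mass_mono_along_axis:
  fixes w :: "'a::euclidean_space" and g :: "'a \<Rightarrow> ennreal"
  assumes dim: "2 \<le> DIM('a)" and w: "norm w = 1" and a: "a > 0"
    and g[measurable]: "g \<in> borel_measurable borel"
    and fin: "\<And>a. (\<integral>\<^sup>+z. indicator (cball 0 a) z * g z \<partial>lborel) < \<infinity>"
    and \<Phi>[measurable]: "\<Phi> \<in> borel_measurable borel"
    and \<Phi>0: "\<Phi> 0 = 0" and \<Phi>M: "\<And>v. norm v = 1 \<Longrightarrow> \<Phi> v \<le> ennreal M" and \<Phi>w: "\<Phi> (- w) = ennreal M" and M: "M > 0"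
    and mono: "\<And>A B. convex_body A \<Longrightarrow> convex_body B \<Longrightarrow> A \<subseteq> B \<Longrightarrow>
       weighted_perimeter g \<Phi> A \<le> weighted_perimeter g \<Phi> B"
  shows "ball_mass g e x \<le> ball_mass g e (x + a *\<^sub>R w)"
proof -
  let ?G = "\<lambda>x. enn2real (ball_mass g e x)"
  have eq: "ennreal (?G x) = ball_mass g e x" for x
    using ball_mass_finite[OF g fin, of e x] by simp
  have mono_y: "weighted_perimeter (\<lambda>x. g (x + y)) \<Phi> (double_cone w r 0) \<le> weighted_perimeter (\<lambda>x. g (x + y)) \<Phi> (double_cone w r d)"
    if "r > 0" "d \<ge> 0" for r d y
    unfolding weighted_perimeter_translate[OF g \<Phi>, symmetric] using that
    by (intro mono convex_body_translate convex_body_double_cone w image_mono double_cone_mono) auto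
  have "?G x \<le> ?G (x + a *\<^sub>R w)"
  proof (rule monotone_along_axis[OF dim w a continuous_on_ball_mass[OF g fin] _ \<Phi> \<Phi>0 \<Phi>M \<Phi>w M])
    fix r d :: real and y :: 'a assume rd: "r > 0" "d \<ge> 0"
    have avg: "weighted_perimeter (\<lambda>x. ball_mass g e (x + y)) \<Phi> (double_cone w r d) =
      (\<integral>\<^sup>+z. indicator (ball 0 e) z * weighted_perimeter (\<lambda>x. g (x + (y + z))) \<Phi> (double_cone w r d) \<partial>lborel)"
      if "d \<ge> 0" for d
      using weighted_perimeter_average[of g \<Phi> lborel "indicator (ball 0 e)" "\<lambda>z. y + z" "double_cone w r d"]
        hausdorff_frontier_double_cone_finite[OF w rd(1) that]
      by (simp add: ball_mass_def lborel.sigma_finite_measure_axioms add.assoc)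
    show "weighted_perimeter (\<lambda>x. ennreal (?G (x + y))) \<Phi> (double_cone w r 0)
       \<le> weighted_perimeter (\<lambda>x. ennreal (?G (x + y))) \<Phi> (double_cone w r d)"
      unfolding eq avg[OF order.refl] avg[OF rd(2)]
      by (intro nn_integral_mono mult_left_mono mono_y rd) auto
  qed auto
  hence "ennreal (?G x) \<le> ennreal (?G (x + a *\<^sub>R w))" by (rule ennreal_leI)
  thus ?thesis unfolding eq .
qed

theorem corollary1p2:
  fixes f :: "(real ^ 'n) \<times> (real ^ 'n) \<Rightarrow> ennreal"
    and g \<Phi> :: "real ^ 'n \<Rightarrow> ennreal"
  assumes "CARD('n) \<ge> 2"
    and "f \<in> borel_measurable borel"
    and "locally_integrable f"
    and "g \<in> borel_measurable borel"
    and "radial g"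
    and "lower_semicontinuous \<Phi>"
    and "positively_1_homogeneous \<Phi>"
    and "ennreal_convex \<Phi>"
    and "\<And>v. v \<noteq> 0 \<Longrightarrow> \<Phi> v > 0"
    and "\<And>x v. f (x, v) = g x * \<Phi> v"
    and "\<And>A B. convex_body A \<Longrightarrow> convex_body B \<Longrightarrow> A \<subseteq> B \<Longrightarrow> perimeter f A \<le> perimeter f B"
  shows "\<exists>c::real. c \<ge> 0 \<and> (AE x in lebesgue. g x = ennreal c)"
proof -
  note g [measurable] = assms(4)
  have \<Phi> [measurable]: "\<Phi> \<in> borel_measurable borel"
    using assms(6) by (rule borel_measurable_lower_semicontinuous)
  define Ig where "Ig a = (\<integral>\<^sup>+x. indicator (cball 0 a) x * g x \<partial>lborel)" for a
  define IP where "IP a = (\<integral>\<^sup>+x. indicator (cball 0 a) x * \<Phi> x \<partial>lborel)" for a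
  have prod: "Ig a * IP b < \<infinity>" for a b
    unfolding Ig_def IP_def by (rule locally_integrable_product_finite[OF assms(2,3,10) g \<Phi>])
  have AE_nat: "AE x in lborel. P x" if "\<And>n::nat. AE x in lborel. x \<in> cball 0 (real n) \<longrightarrow> P x"
    for P :: "real ^ 'n \<Rightarrow> bool"
  proof -
    have "AE x in lborel. \<forall>n::nat. x \<in> cball 0 (real n) \<longrightarrow> P x"
      by (subst AE_all_countable) (intro allI that)
    thus ?thesis by eventually_elim (use real_arch_simple in auto)
  qed
  have "\<exists>c::real. c \<ge> 0 \<and> (AE x in lborel. g x = ennreal c)"
  proof (cases "\<forall>a. Ig a = 0")
    case True
    have "AE x in lborel. g x = 0"
    proof (rule AE_nat)
      fix n :: nat
      have "AE x in lborel. indicator (cball 0 (real n)) x * g x = 0"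
        using True[rule_format, of "real n"] unfolding Ig_def by (subst (asm) nn_integral_0_iff_AE) auto
      thus "AE x in lborel. x \<in> cball 0 (real n) \<longrightarrow> g x = 0" by eventually_elim auto
    qed
    thus ?thesis by (intro exI[of _ 0]) simp
  next
    case False
    then obtain a0 where a0: "Ig a0 > 0" by (auto simp: zero_less_iff_neq_zero)
    have IP_fin: "IP b < \<infinity>" for b
      using prod[of a0 b] a0 by (auto simp: ennreal_mult_less_top)
    have "AE v in lborel. \<Phi> v < \<infinity>"
    proof (rule AE_nat)
      fix n :: nat
      have "AE v in lborel. indicator (cball 0 (real n)) v * \<Phi> v \<noteq> \<infinity>"
        using IP_fin[of "real n"] unfolding IP_def by (intro nn_integral_noteq_infinite) auto
      thus "AE v in lborel. v \<in> cball 0 (real n) \<longrightarrow> \<Phi> v < \<infinity>" by eventually_elim (auto simp: less_top)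
    qed
    hence \<Phi>_fin: "\<Phi> v < \<infinity>" for v by (rule ennreal_convex_finite[OF assms(8) \<Phi>])
    hence \<Phi>_eq: "\<Phi> v = ennreal (enn2real (\<Phi> v))" for v using \<Phi>_fin[of v] by simp
    have IP_pos: "IP 1 > 0"
    proof (rule ccontr)
      assume "\<not> IP 1 > 0"
      hence "IP 1 = 0" by simp
      hence "AE v in lborel. indicator (cball 0 1) v * \<Phi> v = 0"
        unfolding IP_def by (subst (asm) nn_integral_0_iff_AE) auto
      moreover have "AE v::real ^ 'n in lborel. v \<noteq> 0" by (rule AE_lborel_singleton)
      ultimately have "AE v::real ^ 'n in lborel. v \<notin> cball 0 1"
        by eventually_elim (use assms(9) in \<open>fastforce simp: indicator_def\<close>)
      hence "emeasure lborel (cball (0::real ^ 'n) 1) = 0" by (subst (asm) AE_iff_measurable) auto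
      thus False using unit_ball_vol_pos[of "real DIM(real ^ 'n)"] by (simp add: emeasure_cball)
    qed
    have g_fin: "(\<integral>\<^sup>+x. indicator (cball 0 a) x * g x \<partial>lborel) < \<infinity>" for a
      using prod[of a 1] IP_pos by (auto simp: ennreal_mult_less_top Ig_def)
    \<comment> \<open>homogeneity leaves only the values \<open>0\<close> and \<open>\<infinity>\<close>\<close>
    have \<Phi>0: "\<Phi> 0 = 0"
    proof -
      have "\<Phi> (2 *\<^sub>R 0) = ennreal 2 * \<Phi> 0" using assms(7) unfolding positively_1_homogeneous_def by (metis zero_less_numeral)
      hence "ennreal (enn2real (\<Phi> 0)) = ennreal (2 * enn2real (\<Phi> 0))" using \<Phi>_eq[of 0] by (metis enn2real_nonneg ennreal_mult scaleR_zero_right zero_le_numeral)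
      hence "enn2real (\<Phi> 0) = 0" by (subst (asm) ennreal_inj) auto
      thus ?thesis using \<Phi>_eq[of 0] by simp
    qed
    obtain k :: "real ^ 'n" where "k \<in> Basis" using nonempty_Basis by blast
    hence "sphere (0::real ^ 'n) 1 \<noteq> {}" by (auto intro!: exI[of _ k])
    moreover have "continuous_on (sphere 0 1) (\<lambda>v. enn2real (\<Phi> v))"
      using ennreal_convex_continuous[OF assms(8) \<Phi>_fin] by (rule continuous_on_subset) simp
    ultimately obtain v0 where v0: "norm v0 = 1" "\<And>v. norm v = 1 \<Longrightarrow> enn2real (\<Phi> v) \<le> enn2real (\<Phi> v0)"
      using continuous_attains_sup[of "sphere 0 1" "\<lambda>v. enn2real (\<Phi> v)"] by auto
    define M where "M = enn2real (\<Phi> v0)"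
    define w where "w = - v0"
    have w: "norm w = 1" using v0 by (simp add: w_def)
    have "v0 \<noteq> 0" using v0(1) by auto
    hence M: "M > 0" using assms(9)[of v0] \<Phi>_fin[of v0] by (simp add: M_def enn2real_positive_iff)
    have \<Phi>M: "\<Phi> v \<le> ennreal M" if "norm v = 1" for v
      using v0(2)[OF that] by (subst \<Phi>_eq) (simp add: M_def ennreal_leI)
    have \<Phi>w: "\<Phi> (- w) = ennreal M" using \<Phi>_eq by (simp add: M_def w_def)
    have perim: "perimeter f E = weighted_perimeter g \<Phi> E" for E
      by (simp add: perimeter_def weighted_perimeter_def assms(10))
    have dim: "2 \<le> DIM(real ^ 'n)" using assms(1) by simp
    have step: "ball_mass g e x \<le> ball_mass g e (x + a *\<^sub>R w)" if "a > 0" for e x a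
      by (rule ball_mass_mono_along_axis[OF dim w that g g_fin \<Phi> \<Phi>0 \<Phi>M \<Phi>w M])
        (use assms(11) in \<open>simp_all add: perim\<close>)
    show ?thesis
    proof (rule AE_const_if_ball_mass_const[OF g g_fin])
      fix e :: real and x :: "real ^ 'n"
      show "ball_mass g e x = ball_mass g e 0"
      proof (cases "x = 0")
        case False
        hence t: "norm x > 0" by simp
        have rad: "ball_mass g e x = ball_mass g e (norm x *\<^sub>R w)" "ball_mass g e x = ball_mass g e (- (norm x *\<^sub>R w))"
          using w by (intro ball_mass_radial[OF g assms(5)]; simp)+
        \<comment> \<open>monotone along the axis and even, so constant on it\<close>
        have "ball_mass g e 0 \<le> ball_mass g e (norm x *\<^sub>R w)" using step[OF t, of e 0] by simp
        moreover have "ball_mass g e (- (norm x *\<^sub>R w)) \<le> ball_mass g e 0" using step[OF t, of e "- (norm x *\<^sub>R w)"] by simp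
        ultimately show ?thesis using rad by simp
      qed simp
    qed
  qed
  thus ?thesis using AE_completion by blast
qed

end
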